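(* In the setting described in the context, let $\gamma_T^u>0$ be the uplink SINR threshold and let $$\mathsf{SINR}^u_T=\frac{\rho_T H^u_T}{P_{AsD}\,H^u_A\,d_A^{-\alpha_T}+\sigma^2}$$ be the uplink SINR at the terrestrial base station. Put $I=P_{AsD}H^u_A d_A^{-\alpha_T}$ and $\mathcal L_I(s)=\mathbb E[e^{-sI}]$. Then $$\Pr(\mathsf{SINR}^u_T>\gamma_T^u)=\exp\left(-\frac{\gamma_T^u}{\rho_T}\sigma^2\right)\mathcal L_I(s),\qquad s=\frac{\gamma_T^u}{\rho_T},$$ where $\mathcal L_I(s)$ is given as follows. Let $M=\sqrt{h^2+R_2^2}$, $f(z)=2z/R_2^2$, and for $p\ge 0$ $$\ell(s,p|\theta,z)=\frac{1}{1+\dfrac{sp}{\left(z^2-h^2+d^2-2\sqrt{z^2-h^2}\,d\cos\theta\right)^{\alpha_T/2}}}.$$ For $k\in\{L,N\}$ let $D_k=(P_M\eta_k/\rho_A)^{1/\alpha_k}$ and $E_k=\sqrt{D_k^2-R_2^2}$ (read as $0$ if $D_k<R_2$), and $$A_k(a,b)=\int_a^b\int_0^{2\pi}p_k(z)\,\ell\left(s,\tfrac{\rho_A}{\eta_k}z^{\alpha_k}\Big|\theta,z\right)\tfrac{1}{2\pi}f(z)\,d\theta\,dz,$$ $$B_k(a,b)=\int_a^b\int_0^{2\pi}p_k(z)\,\ell(s,P_M|\theta,z)\tfrac{1}{2\pi}f(z)\,d\theta\,dz .$$ Then: (i) if $h\ge D_L$: $\mathcal L_I(s)=\int_h^M\int_0^{2\pi}\ell(s,P_M|\theta,z)\frac1{2\pi}f(z)\,d\theta\,dz$;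 (ii) if $E_L<D_N<h<D_L$ or $D_N<E_L\le h<D_L$: $\mathcal L_I(s)=A_L(h,D_L)+B_L(D_L,M)+B_N(h,M)$; (iii) if $E_L<h\le D_N$: $\mathcal L_I(s)=A_L(h,D_L)+B_L(D_L,M)+A_N(h,D_N)+B_N(D_N,M)$; (iv) if $D_N\le h<E_L$: $\mathcal L_I(s)=A_L(h,M)+B_N(h,M)$; (v) if $E_N<h\le E_L<D_N$ or $E_N<h<D_N<E_L$: $\mathcal L_I(s)=A_L(h,M)+A_N(h,D_N)+B_N(D_N,M)$; (vi) if $h\le E_N$: $\mathcal L_I(s)=A_L(h,M)+A_N(h,M)$.
   Context: Geometry: a terrestrial base station (TBS) is at the origin of the ground plane. A stadium $\mathcal S_2$ is a disk of radius $R_2>0$ in the ground plane whose center is at distance $d>0$ from the TBS. An aerial base station (ABS) is at height $h>0$ above the center of the stadium. An ABS-supported device (AsD) is uniformly distributed on $\mathcal S_2$; $Z_A$ is its 3-D Euclidean distance to the ABS and $d_A$ its distance to the TBS. Aerial link (AsD to ABS): given $Z_A=z$ (and the AsD position), the link is line-of-sight (LOS, index $L$) with probability $p_L(z)\in[0,1]$ and non-line-of-sight (NLOS, index $N$) with probability $p_N(z)=1-p_L(z)$, where $p_L$ is a given measurable function. The aerial path-loss at distance $z$ is $\eta_k z^{-\alpha_k}$ in state $k\in\{L,N\}$, with $\alpha_k,\eta_k>0$, $\eta_L>\eta_N$, and NLOS attenuates more than LOS: $\eta_L z^{-\alpha_L}>\eta_N z^{-\alpha_N}$ for all $z\ge h$.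 AsD power control: the AsD inverts its path-loss to achieve the ABS receiver sensitivity $\rho_A>0$, capped at maximal power $P_M>0$; i.e. in state $k$, $P_{AsD}=\min\{P_M,\ \rho_A Z_A^{\alpha_k}/\eta_k\}$. Terrestrial links have path-loss exponent $\alpha_T>0$ and Rayleigh fading: the power gains $H^u_T$ (TBS user to TBS) and $H^u_A$ (AsD to TBS) are exponential with unit mean. They are independent of each other and of the AsD position and LOS state. The user served by the TBS inverts its path-loss so that its average received power at the TBS is $\rho_T>0$. The noise power is $\sigma^2>0$. Expressions of the form $1/(1+x/0)$ with $x>0$ are read as $0$ (null event). *)

theory Defs
  imports "HOL-Probability.Probability"
begin

datatype link_state = LOS | NLOS

definition link_prob :: "(real \<Rightarrow> real) \<Rightarrow> link_state \<Rightarrow> real \<Rightarrow> real" where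
  "link_prob p\<^sub>L k z = (case k of LOS \<Rightarrow> p\<^sub>L z | NLOS \<Rightarrow> 1 - p\<^sub>L z)"

definition aerial_path_loss ::
    "(link_state \<Rightarrow> real) \<Rightarrow> (link_state \<Rightarrow> real) \<Rightarrow> link_state \<Rightarrow> real \<Rightarrow> real" where
  "aerial_path_loss \<eta> \<alpha> k z = \<eta> k * z powr (- \<alpha> k)"

definition asd_power ::
    "real \<Rightarrow> real \<Rightarrow> (link_state \<Rightarrow> real) \<Rightarrow> (link_state \<Rightarrow> real) \<Rightarrow> link_state \<Rightarrow> real \<Rightarrow> real" where
  "asd_power P\<^sub>M \<rho>\<^sub>A \<eta> \<alpha> k z = min P\<^sub>M (\<rho>\<^sub>A * z powr \<alpha> k / \<eta> k)"

text \<open>The ground plane is \<open>real^2\<close>, with the terrestrial base station at its origin, and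
  three-dimensional space is the Euclidean product \<open>(real^2) \<times> real\<close>, whose second component is
  the height. Below, \<open>c\<close> is the centre of the stadium and \<open>x\<close> a position on the ground.\<close>

definition abs_distance :: "real^2 \<Rightarrow> real \<Rightarrow> real^2 \<Rightarrow> real" where
  "abs_distance c h x = dist (x, 0::real) (c, h)"

definition tbs_distance :: "real^2 \<Rightarrow> real" where
  "tbs_distance x = dist x 0"

text \<open>In \<open>ell\<close>, \<open>q\<close> is the squared distance to the terrestrial base station of the ground
  point at distance \<open>z\<close> from the aerial one and at angle \<open>\<theta>\<close>, as seen from the stadium's centre,
  to the direction of the terrestrial one. The case distinction implements
  \<open>1 / (1 + x / 0) = 0\<close> for \<open>x > 0\<close>, which division in HOL would turn into \<open>1\<close>.\<close>

definition ell :: "real \<Rightarrow> real \<Rightarrow> real \<Rightarrow> real \<Rightarrow> real \<Rightarrow> real \<Rightarrow> real \<Rightarrow> real" where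
  "ell h d \<alpha>\<^sub>T s p \<theta> z =
     (let q = z\<^sup>2 - h\<^sup>2 + d\<^sup>2 - 2 * sqrt (z\<^sup>2 - h\<^sup>2) * d * cos \<theta>
      in if q = 0 \<and> s * p > 0 then 0 else 1 / (1 + s * p / q powr (\<alpha>\<^sub>T / 2)))"

definition laplace_transform :: "'w measure \<Rightarrow> ('w \<Rightarrow> real) \<Rightarrow> real \<Rightarrow> real" where
  "laplace_transform M Y s = (\<integral>w. exp (- s * Y w) \<partial>M)"

end

theory Submission
  imports Defs
begin

text \<open>Conditionally on everything else, \<open>H\<^sub>T\<close> exceeds \<open>s * (I + \<sigma>\<^sup>2)\<close> with probability
  \<open>exp (- s * (I + \<sigma>\<^sup>2))\<close>, which factors the coverage probability through the Laplace transform
  of \<open>I\<close>. Integrating out the fading \<open>H\<^sub>A\<close> turns the latter into the mean of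
  \<open>1 / (1 + s * P * d\<^sub>A powr (- \<alpha>\<^sub>T))\<close>, and conditioning on the position replaces the link state
  by its probabilities. What remains is an integral over the disk, written in polar coordinates
  around its centre with the radius \<open>r\<close> replaced by \<open>z = sqrt (r\<^sup>2 + h\<^sup>2)\<close>; since \<open>r dr = z dz\<close>, the Jacobian
  is \<open>z\<close>. The cases (i)-(vi) record where the distance \<open>D k\<close>, beyond which the power is capped,
  lies relative to the range \<open>[h, Z\<^sub>M]\<close> of \<open>z\<close>.\<close>

subsection \<open>Polar coordinates on the stadium\<close>

lemma borel_measurable_vector2 [measurable (raw)]:
  fixes f g :: "'a \<Rightarrow> real"
  assumes "f \<in> borel_measurable N" "g \<in> borel_measurable N"
  shows "(\<lambda>x. vector [f x, g x] :: real^2) \<in> borel_measurable N"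
proof -
  have "(\<lambda>x. vector [f x, g x] :: real^2) = (\<lambda>x. f x *\<^sub>R axis 1 1 + g x *\<^sub>R axis 2 1)"
    by (auto simp: fun_eq_iff vec_eq_iff forall_2 axis_def)
  with assms show ?thesis by simp
qed

text \<open>Lebesgue measure is determined by its values on boxes, and a box pulls back to a product
  of two intervals. This is the bridge from \<open>real^2\<close>, where the change of variables
  takes place, to the product measure, where Fubini applies.\<close>

lemma lborel_vector2:
  "distr (lborel \<Otimes>\<^sub>M lborel) borel (\<lambda>(a, b). vector [a, b] :: real^2) = lborel"
proof (rule lborel_eqI [symmetric])
  fix l u :: "real^2"
  assume "\<And>b. b \<in> Basis \<Longrightarrow> l \<bullet> b \<le> u \<bullet> b"
  then have le: "l $ 1 \<le> u $ 1" "l $ 2 \<le> u $ 2"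
    by (simp_all add: cart_eq_inner_axis axis_in_Basis_iff)
  have B: "(Basis :: (real^2) set) = {axis 1 1, axis 2 1}"
    by (auto simp: Basis_vec_def UNIV_2)
  have ne: "axis 1 1 \<noteq> (axis 2 1 :: real^2)"
    by (simp add: axis_eq_axis)
  have "(\<lambda>(a, b). vector [a, b] :: real^2) -` box l u \<inter> space (lborel \<Otimes>\<^sub>M lborel)
      = {l $ 1 <..< u $ 1} \<times> {l $ 2 <..< u $ 2}"
    by (auto simp: box_vec_eq_empty mem_box_cart forall_2 space_pair_measure)
  then have "emeasure (distr (lborel \<Otimes>\<^sub>M lborel) borel (\<lambda>(a, b). vector [a, b] :: real^2)) (box l u)
      = emeasure (lborel \<Otimes>\<^sub>M lborel) ({l $ 1 <..< u $ 1} \<times> {l $ 2 <..< u $ 2})"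
    by (subst emeasure_distr) auto
  also have "\<dots> = ennreal (u $ 1 - l $ 1) * ennreal (u $ 2 - l $ 2)"
    using le by (subst lborel.emeasure_pair_measure_Times) auto
  also have "\<dots> = (\<Prod>b\<in>Basis. (u - l) \<bullet> b)"
    using le ne by (simp add: B inner_axis ennreal_mult)
  finally show "emeasure (distr (lborel \<Otimes>\<^sub>M lborel) borel (\<lambda>(a, b). vector [a, b] :: real^2)) (box l u)
      = (\<Prod>b\<in>Basis. (u - l) \<bullet> b)" .
qed simp

text \<open>The ground point at distance \<open>z\<close> from a station at height \<open>h\<close> above \<open>c\<close>; the angle \<open>\<theta>\<close> is measured
  from the direction of the unit vector \<open>u\<close>.\<close>

definition stadium_point :: "real \<Rightarrow> real^2 \<Rightarrow> real^2 \<Rightarrow> real \<Rightarrow> real \<Rightarrow> real^2" where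
  "stadium_point h c u z \<theta> =
     c + sqrt (z\<^sup>2 - h\<^sup>2) *\<^sub>R (cos \<theta> *\<^sub>R u + sin \<theta> *\<^sub>R vector [- u $ 2, u $ 1])"

lemma stadium_point_nth:
  "stadium_point h c u z \<theta> $ 1 = c $ 1 + sqrt (z\<^sup>2 - h\<^sup>2) * (cos \<theta> * u $ 1 - sin \<theta> * u $ 2)"
  "stadium_point h c u z \<theta> $ 2 = c $ 2 + sqrt (z\<^sup>2 - h\<^sup>2) * (cos \<theta> * u $ 2 + sin \<theta> * u $ 1)"
  by (simp_all add: stadium_point_def)

lemma norm_real2_sq: "(norm (x :: real^2))\<^sup>2 = (x $ 1)\<^sup>2 + (x $ 2)\<^sup>2"
  unfolding power2_norm_eq_inner by (simp add: inner_vec_def sum_2 power2_eq_square)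

text \<open>\<open>u\<close> and its quarter turn \<open>vector [- u $ 2, u $ 1]\<close> are
  orthonormal, so the displacement from \<open>c\<close> is a unit vector scaled by the horizontal
  radius.\<close>

lemma norm_stadium_point:
  assumes "norm u = 1" "0 \<le> h" "h \<le> z"
  shows "norm (stadium_point h c u z \<theta> - c) = sqrt (z\<^sup>2 - h\<^sup>2)"
proof -
  have u: "(u $ 1)\<^sup>2 + (u $ 2)\<^sup>2 = 1"
    using assms norm_real2_sq[of u] by simp
  have "(norm (stadium_point h c u z \<theta> - c))\<^sup>2
      = (sqrt (z\<^sup>2 - h\<^sup>2))\<^sup>2 * (((u $ 1)\<^sup>2 + (u $ 2)\<^sup>2) * ((sin \<theta>)\<^sup>2 + (cos \<theta>)\<^sup>2))"
    unfolding norm_real2_sq vector_minus_component stadium_point_nth by algebra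
  also have "\<dots> = (sqrt (z\<^sup>2 - h\<^sup>2))\<^sup>2" by (simp add: u)
  finally show ?thesis
    by (rule power2_eq_imp_eq) (use assms in auto)
qed

text \<open>The derivative of \<open>stadium_point\<close> at distance \<open>y $ 1\<close> and
  angle \<open>y $ 2\<close>, applied to \<open>e\<close>: the first summand differentiates the
  radius \<open>sqrt (z\<^sup>2 - h\<^sup>2)\<close> in \<open>z\<close>, the second turns the
  direction by a right angle.\<close>

definition stadium_deriv :: "real \<Rightarrow> real^2 \<Rightarrow> real^2 \<Rightarrow> real^2 \<Rightarrow> real^2" where
  "stadium_deriv h u y e =
     (y $ 1 / sqrt ((y $ 1)\<^sup>2 - h\<^sup>2) * e $ 1) *\<^sub>R
       (cos (y $ 2) *\<^sub>R u + sin (y $ 2) *\<^sub>R vector [- u $ 2, u $ 1]) +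
     (sqrt ((y $ 1)\<^sup>2 - h\<^sup>2) * e $ 2) *\<^sub>R
       (cos (y $ 2) *\<^sub>R vector [- u $ 2, u $ 1] - sin (y $ 2) *\<^sub>R u)"

lemma stadium_point_derivative:
  fixes y :: "real^2"
  assumes "0 < h" "h < y $ 1"
  shows "((\<lambda>y. stadium_point h c u (y $ 1) (y $ 2)) has_derivative
     stadium_deriv h u y) (at y within S)"
proof -
  have pos: "(y $ 1)\<^sup>2 - h\<^sup>2 > 0" using assms by (simp add: power_strict_mono)
  then have *: "(y $ 1)\<^sup>2 - h\<^sup>2 \<noteq> 0" "sqrt ((y $ 1)\<^sup>2 - h\<^sup>2) \<noteq> 0" "\<not> (y $ 1)\<^sup>2 \<le> h\<^sup>2" by auto
  show ?thesis
    unfolding stadium_point_def stadium_deriv_def [abs_def] using pos *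
    by (auto intro!: derivative_eq_intros bounded_linear.has_derivative [OF bounded_linear_vec_nth]
        simp: fun_eq_iff vec_eq_iff forall_2 field_simps)
qed

text \<open>With \<open>z = y $ 1\<close> and \<open>r = sqrt (z\<^sup>2 - h\<^sup>2)\<close>, the
  columns are orthogonal and positively oriented, of lengths \<open>z / r\<close> and
  \<open>r\<close>.\<close>

lemma stadium_point_jacobian:
  fixes y :: "real^2"
  assumes "norm u = 1" "0 < h" "h < y $ 1"
  shows "det (matrix (stadium_deriv h u y)) = (y $ 1 :: real)"
proof -
  have u: "(u $ 1)\<^sup>2 + (u $ 2)\<^sup>2 = 1"
    using assms norm_real2_sq[of u] by simp
  define r where "r = sqrt ((y $ 1)\<^sup>2 - h\<^sup>2)"
  have r: "r \<noteq> 0" using assms by (simp add: r_def power_strict_mono[of h "y $ 1" 2])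
  \<comment> \<open>This is the expanded determinant. Cancelling \<open>r\<close> needs
    \<open>r \<noteq> 0\<close> and is left to the next step.\<close>
  have "y $ 1 / r * (cos (y $ 2) * u $ 1 - sin (y $ 2) * u $ 2) *
        (r * (cos (y $ 2) * u $ 1 - sin (y $ 2) * u $ 2)) +
      r * (cos (y $ 2) * u $ 2 + sin (y $ 2) * u $ 1) *
        (y $ 1 / r * (cos (y $ 2) * u $ 2 + sin (y $ 2) * u $ 1))
     = (y $ 1 / r * r) * (((u $ 1)\<^sup>2 + (u $ 2)\<^sup>2) * ((sin (y $ 2))\<^sup>2 + (cos (y $ 2))\<^sup>2))"
    by algebra
  also have "\<dots> = y $ 1" using r by (simp add: u)
  finally show ?thesis
    unfolding stadium_deriv_def [abs_def] r_def[symmetric]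
    by (simp add: det_2 matrix_def axis_def algebra_simps)
qed

text \<open>The distance from \<open>c\<close> determines the radius and hence \<open>z\<close>.
  After division by the radius, the direction determines cosine and sine of the angle, hence the
  angle within an open interval of length \<open>2 * pi\<close>.\<close>

lemma stadium_point_inj:
  assumes "norm u = 1" "0 < h"
  shows "inj_on (\<lambda>y::real^2. stadium_point h c u (y $ 1) (y $ 2)) {y. h < y $ 1 \<and> 0 < y $ 2 \<and> y $ 2 < 2 * pi}"
proof (rule inj_onI, clarify)
  fix y y' :: "real^2"
  assume y: "h < y $ 1" "0 < y $ 2" "y $ 2 < 2 * pi" and y': "h < y' $ 1" "0 < y' $ 2" "y' $ 2 < 2 * pi"
    and eq: "stadium_point h c u (y $ 1) (y $ 2) = stadium_point h c u (y' $ 1) (y' $ 2)"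
  have "sqrt ((y $ 1)\<^sup>2 - h\<^sup>2) = sqrt ((y' $ 1)\<^sup>2 - h\<^sup>2)"
    using norm_stadium_point[of u h "y $ 1" c "y $ 2"] norm_stadium_point[of u h "y' $ 1" c "y' $ 2"]
      assms y y' eq by simp
  then have 1: "y $ 1 = y' $ 1" using assms y y' by (auto simp: power2_eq_iff)
  have u: "(u $ 1)\<^sup>2 + (u $ 2)\<^sup>2 = 1"
    using assms norm_real2_sq[of u] by simp
  have r: "sqrt ((y' $ 1)\<^sup>2 - h\<^sup>2) \<noteq> 0"
    using assms y' by (simp add: power_strict_mono[of h "y' $ 1" 2])
  have a: "cos (y $ 2) * u $ 1 - sin (y $ 2) * u $ 2 = cos (y' $ 2) * u $ 1 - sin (y' $ 2) * u $ 2"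
    using arg_cong[OF eq, of "\<lambda>x. x $ 1"] r by (simp add: stadium_point_nth 1)
  have b: "cos (y $ 2) * u $ 2 + sin (y $ 2) * u $ 1 = cos (y' $ 2) * u $ 2 + sin (y' $ 2) * u $ 1"
    using arg_cong[OF eq, of "\<lambda>x. x $ 2"] r by (simp add: stadium_point_nth 1)
  \<comment> \<open>\<open>a\<close> and \<open>b\<close> are a linear system for the differences of
    the cosines and of the sines; its determinant is 1 by \<open>u\<close>.\<close>
  have "cos (y $ 2) = cos (y' $ 2)" "sin (y $ 2) = sin (y' $ 2)"
    using a b u by algebra+
  then obtain n :: int where n: "y $ 2 = y' $ 2 + 2 * pi * n"
    using sin_cos_eq_iff by blast
  have "\<bar>2 * pi * n\<bar> < 2 * pi * 1" using n y y' by auto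
  then have "\<bar>real_of_int n\<bar> < 1" by (simp add: abs_mult)
  then have "n = 0" by linarith
  with n 1 show "y = y'" by (simp add: vec_eq_iff forall_2)
qed

text \<open>The open parameter box misses the boundary circle and the radius at angle 0. The second
  inclusion gives up the whole line through \<open>c\<close> along \<open>u\<close>, since a
  hyperplane is readily seen to be negligible.\<close>

lemma stadium_point_image:
  fixes c u :: "real^2"
  assumes "norm u = 1" "0 < h" "0 < R"
  defines "g \<equiv> \<lambda>y::real^2. stadium_point h c u (y $ 1) (y $ 2)"
    and "S \<equiv> box (vector [h, 0]) (vector [sqrt (h\<^sup>2 + R\<^sup>2), 2 * pi]) :: (real^2) set"
  shows "g ` S \<subseteq> cball c R"
    and "ball c R - {x. vector [- u $ 2, u $ 1] \<bullet> x = vector [- u $ 2, u $ 1] \<bullet> c} \<subseteq> g ` S"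
proof -
  have S: "S = {y. h < y $ 1 \<and> y $ 1 < sqrt (h\<^sup>2 + R\<^sup>2) \<and> 0 < y $ 2 \<and> y $ 2 < 2 * pi}"
    by (auto simp: S_def mem_box_cart forall_2)
  show "g ` S \<subseteq> cball c R"
  proof clarify
    fix y assume "y \<in> S"
    then have y: "h < y $ 1" "y $ 1 < sqrt (h\<^sup>2 + R\<^sup>2)" by (auto simp: S)
    have "(y $ 1)\<^sup>2 < (sqrt (h\<^sup>2 + R\<^sup>2))\<^sup>2"
      by (rule power_strict_mono) (use y assms in auto)
    then have "sqrt ((y $ 1)\<^sup>2 - h\<^sup>2) \<le> R"
      using assms by (intro real_le_lsqrt) (auto simp: power2_eq_square)
    then show "g y \<in> cball c R"
      using norm_stadium_point[of u h "y $ 1" c "y $ 2"] assms y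
      by (simp add: g_def dist_norm norm_minus_commute)
  qed
  have u: "(u $ 1)\<^sup>2 + (u $ 2)\<^sup>2 = 1"
    using assms norm_real2_sq[of u] by simp
  show "ball c R - {x. vector [- u $ 2, u $ 1] \<bullet> x = vector [- u $ 2, u $ 1] \<bullet> c} \<subseteq> g ` S"
  proof (rule subsetI)
    fix x assume *: "x \<in> ball c R - {x. vector [- u $ 2, u $ 1] \<bullet> x = vector [- u $ 2, u $ 1] \<bullet> c}"
    then have x: "x \<in> ball c R"
      and off: "vector [- u $ 2, u $ 1] \<bullet> x \<noteq> vector [- u $ 2, u $ 1] \<bullet> c" by simp_all
    define w where "w = x - c"
    define r where "r = norm w"
    \<comment> \<open>\<open>a\<close> and \<open>b\<close> are the coordinates of \<open>w\<close>
      along \<open>u\<close> and along its quarter turn; \<open>b\<close> vanishes exactly on the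
      excluded line.\<close>
    define a where "a = w $ 1 * u $ 1 + w $ 2 * u $ 2"
    define b where "b = w $ 2 * u $ 1 - w $ 1 * u $ 2"
    have b0: "b \<noteq> 0" using off by (simp add: b_def w_def inner_vec_def sum_2 algebra_simps)
    have "r > 0" using b0 by (auto simp: r_def b_def)
    have "r < R" using x by (simp add: r_def w_def dist_norm norm_minus_commute)
    have r2: "r\<^sup>2 = (w $ 1)\<^sup>2 + (w $ 2)\<^sup>2" by (simp add: r_def norm_real2_sq)
    have "a\<^sup>2 + b\<^sup>2 = r\<^sup>2" unfolding a_def b_def r2 using u by algebra
    then have "(a / r)\<^sup>2 + (b / r)\<^sup>2 = 1"
      using \<open>r > 0\<close> by (simp add: power_divide flip: add_divide_distrib)
    then obtain t where t: "0 \<le> t" "t < 2 * pi" "a / r = cos t" "b / r = sin t"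
      using sincos_total_2pi by metis
    have ab: "a = r * cos t" "b = r * sin t" using t(3,4) \<open>r > 0\<close> by (simp_all add: field_simps)
    have "t \<noteq> 0" using b0 ab by auto
    have "r \<ge> 0" using \<open>r > 0\<close> by simp
    have "w $ 1 = a * u $ 1 - b * u $ 2" "w $ 2 = a * u $ 2 + b * u $ 1"
      unfolding a_def b_def using u by algebra+
    then have "x = g (vector [sqrt (h\<^sup>2 + r\<^sup>2), t])"
      unfolding vec_eq_iff forall_2 by (simp add: g_def stadium_point_nth \<open>r \<ge> 0\<close> w_def ab algebra_simps)
    moreover have "h < sqrt (h\<^sup>2 + r\<^sup>2)" using \<open>r > 0\<close> assms by (intro real_less_rsqrt) auto
    moreover have "sqrt (h\<^sup>2 + r\<^sup>2) < sqrt (h\<^sup>2 + R\<^sup>2)"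
      using \<open>r > 0\<close> \<open>r < R\<close> by (simp add: power_strict_mono)
    ultimately show "x \<in> g ` S"
      using t \<open>t \<noteq> 0\<close> by (intro image_eqI) (auto simp: S)
  qed
qed

lemma measurable_stadium_point [measurable (raw)]:
  assumes [measurable]: "a \<in> borel_measurable N" "b \<in> borel_measurable N"
  shows "(\<lambda>x. stadium_point h c u (a x) (b x)) \<in> borel_measurable N"
  unfolding stadium_point_def by measurable

text \<open>Change of variables on the open box, followed by Fubini. A bounded \<open>F\<close> is
  integrable on the disk, and Fubini also yields integrability of the outer integrand, which later
  permits cutting the range of \<open>z\<close> into pieces.\<close>

proposition
  fixes F :: "real^2 \<Rightarrow> real"
  assumes u: "norm u = 1" and h: "0 < h" and R: "0 < R"
    and F [measurable]: "F \<in> borel_measurable borel" and B: "\<And>x. \<bar>F x\<bar> \<le> B"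
  shows stadium_integral: "(LINT x : cball c R | lborel. F x)
      = (LBINT z=ereal h..ereal (sqrt (h\<^sup>2 + R\<^sup>2)). (LBINT \<theta>=0..ereal (2 * pi). z * F (stadium_point h c u z \<theta>)))"
    (is "?L = ?I")
    and stadium_integrable: "interval_lebesgue_integrable lborel (ereal h) (ereal (sqrt (h\<^sup>2 + R\<^sup>2)))
       (\<lambda>z. (LBINT \<theta>=0..ereal (2 * pi). z * F (stadium_point h c u z \<theta>)))"
proof -
  define g where "g = (\<lambda>y::real^2. stadium_point h c u (y $ 1) (y $ 2))"
  define S :: "(real^2) set" where "S = box (vector [h, 0]) (vector [sqrt (h\<^sup>2 + R\<^sup>2), 2 * pi])"
  have S: "S = {y. h < y $ 1 \<and> y $ 1 < sqrt (h\<^sup>2 + R\<^sup>2) \<and> 0 < y $ 2 \<and> y $ 2 < 2 * pi}"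
    by (auto simp: S_def mem_box_cart forall_2)
  have Sm [measurable]: "S \<in> sets borel" by (simp add: S_def)
  define v :: "real^2" where "v = vector [- u $ 2, u $ 1]"
  have "v \<noteq> 0" using u by (auto simp: v_def vec_eq_iff forall_2 norm_eq_sqrt_inner inner_vec_def sum_2)
  have sub: "g ` S \<subseteq> cball c R" "ball c R - {x. v \<bullet> x = v \<bullet> c} \<subseteq> g ` S"
    using stadium_point_image[OF u h R, of c] by (auto simp: g_def S_def v_def)
  \<comment> \<open>The image of the box fills the disk up to part of a circle and a line, so
    integrating \<open>F\<close> over either gives the same value.\<close>
  have "negligible (sphere c R \<union> {x. v \<bullet> x = v \<bullet> c})"
    using \<open>v \<noteq> 0\<close> by (simp add: negligible_hyperplane negligible_sphere)
  moreover have "cball c R - g ` S \<subseteq> sphere c R \<union> {x. v \<bullet> x = v \<bullet> c}"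
    using sub(2) by (force simp: subset_iff)
  ultimately have neg: "negligible (cball c R - g ` S)" by (rule negligible_subset)
  have Fc: "set_integrable lborel (cball c R) F"
    unfolding set_integrable_def
    by (rule integrableI_bounded_set_indicator[where B=B])
       (use B emeasure_lborel_cball_finite[of c R] in auto)
  then have Fc': "F absolutely_integrable_on cball c R"
    unfolding set_integrable_def by (subst integrable_completion) auto
  have Fg: "F absolutely_integrable_on g ` S"
    using Fc' by (subst absolutely_integrable_spike_set_eq[of _ "cball c R"])
      (use sub neg in \<open>auto intro: negligible_subset simp: Diff_eq_empty_iff[THEN iffD2]\<close>)
  have inj: "inj_on g S"
    using stadium_point_inj[OF u h, of c] unfolding g_def by (rule inj_on_subset) (auto simp: S)
  have der: "(g has_derivative stadium_deriv h u y) (at y within S)" if "y \<in> S" for y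
    unfolding g_def by (rule stadium_point_derivative) (use that h S in auto)
  have det: "\<bar>det (matrix (stadium_deriv h u y))\<bar> = y $ 1" if "y \<in> S" for y
    using stadium_point_jacobian[OF u h, of y] that h by (auto simp: S)
  \<comment> \<open>The change of variables theorem concerns vector-valued functions, so
    \<open>F\<close> is wrapped into \<open>real^1\<close> by \<open>vec\<close> and unwrapped
    afterwards.\<close>
  have "(\<lambda>y. \<bar>det (matrix (stadium_deriv h u y))\<bar> *\<^sub>R (vec (F (g y)) :: real^1)) absolutely_integrable_on S \<and>
      integral S (\<lambda>y. \<bar>det (matrix (stadium_deriv h u y))\<bar> *\<^sub>R (vec (F (g y)) :: real^1)) = vec (integral (g ` S) F)"
    using Fg by (subst has_absolute_integral_change_of_variables[OF _ der inj])
      (auto simp: absolutely_integrable_on_1_iff integral_on_1_eq)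
  then have "(\<lambda>y. \<bar>det (matrix (stadium_deriv h u y))\<bar> * F (g y)) absolutely_integrable_on S"
    "integral S (\<lambda>y. \<bar>det (matrix (stadium_deriv h u y))\<bar> * F (g y)) = integral (g ` S) F"
    by (simp_all add: absolutely_integrable_on_1_iff integral_on_1_eq)
  moreover have "(\<lambda>y. \<bar>det (matrix (stadium_deriv h u y))\<bar> * F (g y)) absolutely_integrable_on S \<longleftrightarrow>
      (\<lambda>y. y $ 1 * F (g y)) absolutely_integrable_on S"
    by (rule set_integrable_cong) (auto simp: det)
  moreover have "integral S (\<lambda>y. \<bar>det (matrix (stadium_deriv h u y))\<bar> * F (g y)) = integral S (\<lambda>y. y $ 1 * F (g y))"
    by (rule integral_cong) (simp add: det)
  ultimately have D: "(\<lambda>y. y $ 1 * F (g y)) absolutely_integrable_on S"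
    "integral S (\<lambda>y. y $ 1 * F (g y)) = integral (g ` S) F" by simp_all
  have Dm [measurable]: "(\<lambda>y. y $ 1 * F (g y)) \<in> borel_measurable borel"
    unfolding g_def by measurable
  \<comment> \<open>Absolute integrability refers to the completed measure; Borel measurability
    brings it back to \<open>lborel\<close>.\<close>
  have Db: "set_integrable lborel S (\<lambda>y. y $ 1 * F (g y))"
    using D(1) unfolding set_integrable_def by (subst (asm) integrable_completion) auto
  have "?L = integral (cball c R) F"
    by (rule set_borel_integral_eq_integral(2)[OF Fc])
  also have "\<dots> = integral (g ` S) F"
    by (rule integral_spike_set) (use neg sub in \<open>auto intro: negligible_subset simp: Diff_eq_empty_iff[THEN iffD2]\<close>)
  also have "\<dots> = (LINT y : S | lborel. y $ 1 * F (g y))"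
    using D(2) set_borel_integral_eq_integral(2)[OF Db] by simp
  finally have L: "?L = (LINT y : S | lborel. y $ 1 * F (g y))" .
  \<comment> \<open>The value at the null event \<open>x = 0\<close> is chosen to match the convention in \<open>ell\<close>.\<close>
  define G where "G = (\<lambda>(a, b). indicator {h<..<sqrt (h\<^sup>2 + R\<^sup>2)} a * (indicator {0<..<2 * pi} b *
     (a * F (stadium_point h c u a b))))"
  \<comment> \<open>\<open>G\<close> is the integrand over \<open>S\<close> composed with the
    pairing map, so \<open>lborel_vector2\<close> moves the integral to the product measure. The two
    indicator factors turn into the two interval integrals.\<close>
  have G: "(\<lambda>(a, b). indicator S (vector [a, b]) *\<^sub>R ((vector [a, b] :: real^2) $ 1 * F (g (vector [a, b])))) = G"
    by (auto simp: G_def S g_def indicator_def fun_eq_iff)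
  have "integrable (lborel \<Otimes>\<^sub>M lborel) G"
    using Db unfolding set_integrable_def
    by (subst (asm) lborel_vector2[symmetric], subst (asm) integrable_distr_eq)
       (simp_all add: G split_beta' flip: G)
  moreover have "(LINT y : S | lborel. y $ 1 * F (g y)) = integral\<^sup>L (lborel \<Otimes>\<^sub>M lborel) G"
    unfolding set_lebesgue_integral_def
    by (subst lborel_vector2[symmetric], subst integral_distr)
       (simp_all add: G split_beta' flip: G)
  ultimately have "integrable lborel (\<lambda>a. \<integral>b. G (a, b) \<partial>lborel)"
     "?L = (\<integral>a. \<integral>b. G (a, b) \<partial>lborel \<partial>lborel)"
    using lborel_pair.integrable_fst'[of G] lborel_pair.integral_fst'[of G] by (simp_all add: L)
  moreover have "h \<le> sqrt (h\<^sup>2 + R\<^sup>2)" using h by (intro real_le_rsqrt) auto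
  moreover have "(\<integral>b. G (a, b) \<partial>lborel) = indicator {h<..<sqrt (h\<^sup>2 + R\<^sup>2)} a *
     (LBINT \<theta>=0..ereal (2 * pi). a * F (stadium_point h c u a \<theta>))" for a
    by (simp add: G_def interval_lebesgue_integral_def zero_ereal_def set_lebesgue_integral_def
        mult.left_commute[of _ a])
  ultimately show "?L = ?I" "interval_lebesgue_integrable lborel (ereal h) (ereal (sqrt (h\<^sup>2 + R\<^sup>2)))
       (\<lambda>z. (LBINT \<theta>=0..ereal (2 * pi). z * F (stadium_point h c u z \<theta>)))"
    by (simp_all add: interval_lebesgue_integral_def[of _ "ereal h"] interval_lebesgue_integrable_def
        set_lebesgue_integral_def set_integrable_def del: interval_lebesgue_integral_mult_right)
qed

subsection \<open>Exponential fading and conditioning\<close>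

text \<open>Independence makes the joint law the product of the marginal laws, as is checked on
  rectangles; Fubini then integrates \<open>X\<close> with \<open>Y\<close> frozen. Generated
  sigma-algebras express independence because \<open>X\<close> and \<open>Y\<close> may have values
  of different types.\<close>

lemma (in prob_space) iterated_expectation_indep:
  fixes f :: "'b \<times> 'c \<Rightarrow> real"
  assumes rv [measurable]: "random_variable S X" "random_variable T Y"
    and ind: "indep_set (sets (vimage_algebra (space M) X S)) (sets (vimage_algebra (space M) Y T))"
    and f [measurable]: "f \<in> borel_measurable (S \<Otimes>\<^sub>M T)" and B: "\<And>z. \<bar>f z\<bar> \<le> B"
  shows "expectation (\<lambda>w. f (X w, Y w)) = expectation (\<lambda>w. expectation (\<lambda>w'. f (X w', Y w)))"
proof -
  interpret X: prob_space "distr M S X" by (rule prob_space_distr) simp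
  interpret Y: prob_space "distr M T Y" by (rule prob_space_distr) simp
  interpret XY: pair_prob_space "distr M S X" "distr M T Y" ..
  have "integrable (distr M S X \<Otimes>\<^sub>M distr M T Y) f"
    using B by (intro XY.integrable_const_bound[where B=B]) auto
  then have "integrable (distr M S X \<Otimes>\<^sub>M distr M T Y) (\<lambda>(x, y). f (x, y))" by simp
  from XY.integral_snd[OF this]
  have "(\<integral>z. f z \<partial>(distr M S X \<Otimes>\<^sub>M distr M T Y)) = (\<integral>y. \<integral>x. f (x, y) \<partial>distr M S X \<partial>distr M T Y)"
    by simp
  also have "distr M S X \<Otimes>\<^sub>M distr M T Y = distr M (S \<Otimes>\<^sub>M T) (\<lambda>w. (X w, Y w))"
  proof (rule pair_measure_eqI)
    fix A B assume "A \<in> sets (distr M S X)" "B \<in> sets (distr M T Y)"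
    then have [measurable]: "A \<in> sets S" "B \<in> sets T" by simp_all
    have "prob ((X -` A \<inter> space M) \<inter> (Y -` B \<inter> space M)) = prob (X -` A \<inter> space M) * prob (Y -` B \<inter> space M)"
      by (rule indep_setD[OF ind]) (auto intro: in_vimage_algebra)
    moreover have "(\<lambda>w. (X w, Y w)) -` (A \<times> B) \<inter> space M = (X -` A \<inter> space M) \<inter> (Y -` B \<inter> space M)"
      by auto
    ultimately show "emeasure (distr M S X) A * emeasure (distr M T Y) B
        = emeasure (distr M (S \<Otimes>\<^sub>M T) (\<lambda>w. (X w, Y w))) (A \<times> B)"
      by (simp add: emeasure_distr emeasure_eq_measure ennreal_mult)
  qed (simp_all add: X.sigma_finite_measure_axioms Y.sigma_finite_measure_axioms cong: sets_pair_measure_cong)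
  also have "(\<integral>y. \<integral>x. f (x, y) \<partial>distr M S X \<partial>distr M T Y) = expectation (\<lambda>w. \<integral>x. f (x, Y w) \<partial>distr M S X)"
    by (subst integral_distr) auto
  also have "\<dots> = expectation (\<lambda>w. expectation (\<lambda>w'. f (X w', Y w)))"
  proof (intro Bochner_Integration.integral_cong refl integral_distr)
    fix w assume "w \<in> space M"
    then have [simp]: "Y w \<in> space T" using rv(2) by (rule measurable_space[rotated])
    show "(\<lambda>x. f (x, Y w)) \<in> borel_measurable S" by measurable
  qed auto
  finally show ?thesis by (simp add: integral_distr)
qed

text \<open>Multiplying the unit exponential density by \<open>exp (- (b * x))\<close> gives
  \<open>1 / (1 + b)\<close> times the exponential density of rate \<open>1 + b\<close>, which has
  total mass 1.\<close>

lemma (in prob_space) exponential_distributed_laplace: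
  assumes D: "distributed M lborel H (exponential_density 1)" and b: "0 \<le> b"
  shows "expectation (\<lambda>w. exp (- (b * H w))) = 1 / (1 + b)"
proof -
  have "expectation (\<lambda>w. exp (- (b * H w))) = (\<integral>x. exponential_density 1 x * exp (- (b * x)) \<partial>lborel)"
    by (rule distributed_integral[OF D, symmetric]) (auto simp: exponential_density_nonneg)
  also have "\<dots> = (\<integral>x. exponential_density (1 + b) x / (1 + b) \<partial>lborel)"
  proof (rule Bochner_Integration.integral_cong [OF refl])
    fix x :: real
    have "exp (- x) * exp (- (b * x)) = exp (- (x * (1 + b)))"
      by (simp add: mult_exp_exp algebra_simps)
    then show "exponential_density 1 x * exp (- (b * x)) = exponential_density (1 + b) x / (1 + b)"
      using b by (auto simp: exponential_density_def)
  qed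
  also have "\<dots> = (\<integral>x. exponential_density (1 + b) x \<partial>lborel) / (1 + b)"
    by simp
  also have "(\<integral>x. exponential_density (1 + b) x \<partial>lborel) = 1"
  proof -
    interpret E: prob_space "density lborel (exponential_density (1 + b))"
      using b by (intro prob_space_exponential_density) simp
    have "1 = measure (density lborel (exponential_density (1 + b))) UNIV"
      using E.prob_space by simp
    also have "\<dots> = (\<integral>x. 1 \<partial>density lborel (exponential_density (1 + b)))"
      by simp
    also have "\<dots> = (\<integral>x. exponential_density (1 + b) x \<partial>lborel)"
      using b by (subst integral_density) (auto simp: exponential_density_nonneg)
    finally show ?thesis by simp
  qed
  finally show ?thesis .
qed

text \<open>This allows a fading gain \<open>H\<close> to be replaced by \<open>max 0 H\<close>
  wherever a sign or a bound is wanted for all values.\<close>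

lemma (in prob_space) exponential_distributed_nonneg:
  assumes D: "distributed M lborel H (exponential_density 1)"
  shows "AE w in M. 0 < H w"
proof -
  have [measurable]: "H \<in> borel_measurable M" using distributed_measurable[OF D] by simp
  have "\<P>(w in M. 0 < H w) = 1" using exponential_distributedD_gt[OF D, of 0] by simp
  then show ?thesis by (subst (asm) prob_Collect_eq_1) auto
qed

text \<open>Every event of \<open>X'\<close> is an event of the pair, with \<open>UNIV\<close> as
  first factor, and a smaller family of events inherits independence.\<close>

lemma (in prob_space) indep_set_vimage_snd:
  assumes Y: "indep_set (sets (vimage_algebra (space M) (\<lambda>w. (X w, X' w)) (borel \<Otimes>\<^sub>M borel))) \<A>"
  shows "indep_set (sets (vimage_algebra (space M) X' borel)) \<A>"
proof -
  have "sets (vimage_algebra (space M) X' borel)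
      \<subseteq> sets (vimage_algebra (space M) (\<lambda>w. (X w, X' w)) (borel \<Otimes>\<^sub>M borel))"
  proof
    fix A assume "A \<in> sets (vimage_algebra (space M) X' borel)"
    then obtain B where "B \<in> sets borel" and A: "A = X' -` B \<inter> space M"
      by (auto simp: sets_vimage_algebra2)
    then have "UNIV \<times> B \<in> sets (borel \<Otimes>\<^sub>M borel)"
      by (intro pair_measureI) auto
    then have "(\<lambda>w. (X w, X' w)) -` (UNIV \<times> B) \<inter> space M
        \<in> sets (vimage_algebra (space M) (\<lambda>w. (X w, X' w)) (borel \<Otimes>\<^sub>M borel))"
      by (rule in_vimage_algebra)
    also have "(\<lambda>w. (X w, X' w)) -` (UNIV \<times> B) \<inter> space M = A"
      by (auto simp: A)
    finally show "A \<in> sets (vimage_algebra (space M) (\<lambda>w. (X w, X' w)) (borel \<Otimes>\<^sub>M borel))" .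
  qed
  with Y show ?thesis by (auto simp: indep_sets2_eq)
qed

text \<open>First \<open>Y\<close> and then \<open>H\<^sub>A\<close> is frozen; what remains is the
  tail of a unit exponential at a fixed level. The tail formula holds for nonnegative levels, whence
  \<open>nonneg\<close> for all arguments.\<close>

lemma (in prob_space) exponential_exceeds_independent:
  assumes T: "distributed M lborel H\<^sub>T (exponential_density 1)"
    and H: "indep_var borel H\<^sub>T borel H\<^sub>A"
    and Ym [measurable]: "random_variable N Y"
    and Y: "indep_set (sets (vimage_algebra (space M) (\<lambda>w. (H\<^sub>T w, H\<^sub>A w)) (borel \<Otimes>\<^sub>M borel)))
           (sets (vimage_algebra (space M) Y N))"
    and V [measurable]: "(\<lambda>(a, y). V a y) \<in> borel_measurable (borel \<Otimes>\<^sub>M N)"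
    and nonneg: "\<And>a y. (0 :: real) \<le> V a y"
  shows "\<P>(w in M. V (H\<^sub>A w) (Y w) < H\<^sub>T w) = expectation (\<lambda>w. exp (- V (H\<^sub>A w) (Y w)))"
proof -
  have [measurable]: "H\<^sub>T \<in> borel_measurable M" "H\<^sub>A \<in> borel_measurable M"
    using H by (auto dest: indep_var_rv1 indep_var_rv2)
  define f where "f = (\<lambda>((t, a), y). of_bool (V a y < t) :: real)"
  have Vm [measurable]: "(\<lambda>x. V (g x) (k x)) \<in> borel_measurable L"
    if [measurable]: "g \<in> borel_measurable L" "k \<in> measurable L N" for L :: "'x measure" and g k
    using measurable_compose[OF measurable_Pair[OF that] V] by simp
  have fm [measurable]: "f \<in> borel_measurable ((borel \<Otimes>\<^sub>M borel) \<Otimes>\<^sub>M N)"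
    unfolding f_def split_beta' by measurable
  have A: "indep_set (sets (vimage_algebra (space M) H\<^sub>A borel)) (sets (vimage_algebra (space M) Y N))"
    by (rule indep_set_vimage_snd[OF Y])
  have H': "indep_set (sets (vimage_algebra (space M) H\<^sub>T borel)) (sets (vimage_algebra (space M) H\<^sub>A borel))"
    using H by (simp add: indep_var_eq sets_vimage_algebra)
  have "\<P>(w in M. V (H\<^sub>A w) (Y w) < H\<^sub>T w) = expectation (\<lambda>w. f ((H\<^sub>T w, H\<^sub>A w), Y w))"
  proof -
    have "expectation (\<lambda>w. f ((H\<^sub>T w, H\<^sub>A w), Y w))
        = expectation (indicator {w \<in> space M. V (H\<^sub>A w) (Y w) < H\<^sub>T w})"
      by (rule Bochner_Integration.integral_cong) (auto simp: f_def)
    then show ?thesis by simp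
  qed
  also have "\<dots> = expectation (\<lambda>w. expectation (\<lambda>w'. f ((H\<^sub>T w', H\<^sub>A w'), Y w)))"
    by (rule iterated_expectation_indep[OF _ _ Y fm, of 1]) (auto simp: f_def)
  also have "\<dots> = expectation (\<lambda>w. expectation (\<lambda>w'. exp (- V (H\<^sub>A w') (Y w))))"
  proof (rule Bochner_Integration.integral_cong [OF refl])
    fix w assume "w \<in> space M"
    then have [simp]: "Y w \<in> space N" by (rule measurable_space[rotated]) simp
    have "expectation (\<lambda>w'. f ((H\<^sub>T w', H\<^sub>A w'), Y w))
        = expectation (\<lambda>w'. expectation (\<lambda>w''. f ((H\<^sub>T w'', H\<^sub>A w'), Y w)))"
      by (rule iterated_expectation_indep[OF _ _ H', of "\<lambda>z. f (z, Y w)" 1]) (auto simp: f_def split_beta')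
    moreover have "expectation (\<lambda>w''. f ((H\<^sub>T w'', H\<^sub>A w'), Y w)) = exp (- V (H\<^sub>A w') (Y w))" for w'
    proof -
      have "expectation (\<lambda>w''. f ((H\<^sub>T w'', H\<^sub>A w'), Y w))
          = expectation (indicator {w'' \<in> space M. V (H\<^sub>A w') (Y w) < H\<^sub>T w''})"
        by (rule Bochner_Integration.integral_cong) (auto simp: f_def)
      then show ?thesis
        using exponential_distributedD_gt[OF T, of "V (H\<^sub>A w') (Y w)"] nonneg by simp
    qed
    ultimately show "expectation (\<lambda>w'. f ((H\<^sub>T w', H\<^sub>A w'), Y w)) = expectation (\<lambda>w'. exp (- V (H\<^sub>A w') (Y w)))"
      by simp
  qed
  \<comment> \<open>With \<open>H\<^sub>T\<close> integrated out, the freezing of \<open>Y\<close>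
    is undone by the same iteration, now for \<open>H\<^sub>A\<close> and \<open>Y\<close>.\<close>
  also have "\<dots> = expectation (\<lambda>w. exp (- V (H\<^sub>A w) (Y w)))"
    using nonneg by (subst iterated_expectation_indep[OF _ _ A, of "\<lambda>(a, y). exp (- V a y)" 1, simplified]) auto
  finally show ?thesis .
qed

text \<open>Split by the value of \<open>K\<close> with indicators. Each factor
  \<open>G k (X w)\<close> is measurable for the sigma-algebra of \<open>X\<close>, so the indicator
  beside it may be replaced by its conditional expectation.\<close>

lemma (in prob_space) expectation_split_conditional:
  fixes G :: "link_state \<Rightarrow> 'b \<Rightarrow> real"
  assumes X [measurable]: "X \<in> measurable M N" and K [measurable]: "K \<in> measurable M (count_space UNIV)"
    and G [measurable]: "\<And>k. G k \<in> borel_measurable N" and B: "\<And>k x. \<bar>G k x\<bar> \<le> B"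
    and q: "\<And>k. AE w in M. real_cond_exp M (vimage_algebra (space M) X N)
              (indicator {v \<in> space M. K v = k}) w = q k (X w)"
    and qm [measurable]: "\<And>k. q k \<in> borel_measurable N"
  shows "expectation (\<lambda>w. G (K w) (X w)) = expectation (\<lambda>w. q LOS (X w) * G LOS (X w)) + expectation (\<lambda>w. q NLOS (X w) * G NLOS (X w))"
proof -
  define F where "F = vimage_algebra (space M) X N"
  have XF [measurable]: "X \<in> measurable F N"
    unfolding F_def using measurable_space[OF X] by (intro measurable_vimage_algebra1) auto
  have "subalgebra M F"
    unfolding subalgebra_def F_def using measurable_space[OF X]
    by (auto simp: sets_vimage_algebra2 Pi_iff)
  then interpret finite_measure_subalgebra M F by unfold_locales
  have Kset [measurable]: "{v \<in> space M. K v = k} \<in> sets M" for k by measurable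
  have int: "integrable M (\<lambda>w. G k (X w) * indicator {v \<in> space M. K v = k} w)" for k
    by (rule integrable_const_bound[where B=B])
       (use B order_trans[OF abs_ge_zero B] in \<open>auto simp: indicator_def\<close>)
  have "expectation (\<lambda>w. G (K w) (X w))
      = expectation (\<lambda>w. G LOS (X w) * indicator {v \<in> space M. K v = LOS} w + G NLOS (X w) * indicator {v \<in> space M. K v = NLOS} w)"
  proof (rule Bochner_Integration.integral_cong [OF refl])
    fix w assume "w \<in> space M"
    then show "G (K w) (X w) = G LOS (X w) * indicator {v \<in> space M. K v = LOS} w + G NLOS (X w) * indicator {v \<in> space M. K v = NLOS} w"
      by (cases "K w") auto
  qed
  also have "\<dots> = expectation (\<lambda>w. G LOS (X w) * indicator {v \<in> space M. K v = LOS} w)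
      + expectation (\<lambda>w. G NLOS (X w) * indicator {v \<in> space M. K v = NLOS} w)"
    by (intro Bochner_Integration.integral_add int)
  moreover have "expectation (\<lambda>w. G k (X w) * indicator {v \<in> space M. K v = k} w)
      = expectation (\<lambda>w. q k (X w) * G k (X w))" for k
  proof -
    have "expectation (\<lambda>w. G k (X w) * indicator {v \<in> space M. K v = k} w)
       = expectation (\<lambda>w. G k (X w) * real_cond_exp M F (indicator {v \<in> space M. K v = k}) w)"
      by (rule real_cond_exp_intg(2)[OF int, symmetric]) auto
    also have "\<dots> = expectation (\<lambda>w. q k (X w) * G k (X w))"
      by (rule integral_cong_AE) (use q[of k] in \<open>auto simp: F_def\<close>)
    finally show ?thesis .
  qed
  ultimately show ?thesis by simp
qed

text \<open>The law of \<open>X\<close> has the constant density \<open>1 / measure lborel A\<close>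
  on \<open>A\<close>; \<open>fin\<close> turns the extended quotient into this real one.\<close>

lemma (in prob_space) expectation_uniform:
  fixes F :: "'b::euclidean_space \<Rightarrow> real"
  assumes X [measurable]: "X \<in> borel_measurable M"
    and U: "distr M lborel X = uniform_measure lborel A" and A [measurable]: "A \<in> sets borel"
    and fin: "emeasure lborel A \<noteq> 0" "emeasure lborel A \<noteq> \<infinity>"
    and F [measurable]: "F \<in> borel_measurable borel"
  shows "expectation (\<lambda>w. F (X w)) = (LINT x : A | lborel. F x) / measure lborel A"
proof -
  have "expectation (\<lambda>w. F (X w)) = (\<integral>x. F x \<partial>uniform_measure lborel A)"
    by (simp add: integral_distr flip: U)
  also have "uniform_measure lborel A = density lborel (\<lambda>x. ennreal (indicator A x / measure lborel A))"
    unfolding uniform_measure_def using fin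
    by (intro density_cong AE_I2)
      (auto simp: indicator_def emeasure_eq_ennreal_measure measure_eq_0_null_sets
         zero_less_measure_iff simp flip: divide_ennreal)
  also have "(\<integral>x. F x \<partial>\<dots>) = (LINT x : A | lborel. F x) / measure lborel A"
    by (subst integral_density) (auto simp: set_lebesgue_integral_def)
  finally show ?thesis .
qed

subsection \<open>Path loss and power control in stadium coordinates\<close>

lemma abs_distance_eq: "abs_distance c h x = sqrt ((norm (x - c))\<^sup>2 + h\<^sup>2)"
  by (simp add: abs_distance_def dist_Pair_Pair dist_norm norm_Pair)

text \<open>By Pythagoras, the parameter \<open>z\<close> is the distance to the aerial station
  itself.\<close>

lemma abs_distance_stadium_point:
  assumes "norm u = 1" "0 < h" "h \<le> z"
  shows "abs_distance c h (stadium_point h c u z \<theta>) = z"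
proof -
  have "h\<^sup>2 \<le> z\<^sup>2" using assms by (simp add: power_mono)
  then show ?thesis
    using assms by (simp add: abs_distance_eq norm_stadium_point)
qed

text \<open>The law of cosines: with the centre at \<open>- d *\<^sub>R u\<close>, the vector
  \<open>u\<close> points from the centre to the terrestrial station at the origin.\<close>

lemma norm_stadium_point_sq:
  assumes "norm u = 1" "0 < h" "h \<le> z"
  shows "(norm (stadium_point h (- d *\<^sub>R u) u z \<theta>))\<^sup>2
    = z\<^sup>2 - h\<^sup>2 + d\<^sup>2 - 2 * sqrt (z\<^sup>2 - h\<^sup>2) * d * cos \<theta>"
proof -
  have "h\<^sup>2 \<le> z\<^sup>2" using assms by (simp add: power_mono)
  define r where "r = sqrt (z\<^sup>2 - h\<^sup>2)"
  have r: "r\<^sup>2 = z\<^sup>2 - h\<^sup>2" using \<open>h\<^sup>2 \<le> z\<^sup>2\<close> by (simp add: r_def)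
  have u: "(u $ 1)\<^sup>2 + (u $ 2)\<^sup>2 = 1"
    using assms norm_real2_sq[of u] by simp
  have "(norm (stadium_point h (- d *\<^sub>R u) u z \<theta>))\<^sup>2
     = (- d * u $ 1 + r * (cos \<theta> * u $ 1 - sin \<theta> * u $ 2))\<^sup>2 +
       (- d * u $ 2 + r * (cos \<theta> * u $ 2 + sin \<theta> * u $ 1))\<^sup>2"
    unfolding norm_real2_sq stadium_point_nth r_def by simp
  also have "\<dots> = ((u $ 1)\<^sup>2 + (u $ 2)\<^sup>2) * (r\<^sup>2 * ((sin \<theta>)\<^sup>2 + (cos \<theta>)\<^sup>2) + d\<^sup>2 - 2 * r * d * cos \<theta>)"
    by algebra
  also have "\<dots> = r\<^sup>2 + d\<^sup>2 - 2 * r * d * cos \<theta>" by (simp add: u)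
  finally show ?thesis by (simp add: r flip: r_def)
qed

text \<open>The quantity \<open>q\<close> in \<open>ell\<close> is \<open>(norm x)\<^sup>2\<close>.
  As \<open>s * p\<close> is positive, the special case of \<open>ell\<close> occurs exactly at
  \<open>x = 0\<close>.\<close>

lemma ell_stadium_point:
  fixes u :: "real^2" and d \<theta> :: real
  assumes "norm u = 1" "0 < h" "h \<le> z" "0 < s * p"
  defines "x \<equiv> stadium_point h (- d *\<^sub>R u) u z \<theta>"
  shows "ell h d a s p \<theta> z = (if x = 0 then 0 else 1 / (1 + s * (p * norm x powr (- a))))"
proof -
  have q: "z\<^sup>2 - h\<^sup>2 + d\<^sup>2 - 2 * sqrt (z\<^sup>2 - h\<^sup>2) * d * cos \<theta> = (norm x)\<^sup>2"
    using norm_stadium_point_sq[OF assms(1-3)] by (simp add: x_def)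
  have "((norm x)\<^sup>2) powr (a / 2) = norm x powr a" if "x \<noteq> 0"
    using that by (simp add: powr_powr flip: powr_numeral)
  then show ?thesis
    unfolding ell_def q using assms(4) by (auto simp: powr_minus_divide)
qed

lemma countable_UNIV_link_state: "countable (UNIV :: link_state set)"
proof -
  have "(UNIV :: link_state set) = {LOS, NLOS}" using link_state.exhaust by auto
  then show ?thesis by (metis countable_finite finite.emptyI finite_insert)
qed

lemma borel_measurable_abs_distance [measurable]: "abs_distance c h \<in> borel_measurable borel"
  unfolding abs_distance_eq [abs_def] by measurable

lemma borel_measurable_tbs_distance [measurable]: "tbs_distance \<in> borel_measurable borel"
  unfolding tbs_distance_def [abs_def] by measurable

lemma borel_measurable_asd_power [measurable]: "asd_power P\<^sub>M \<rho>\<^sub>A \<eta> \<alpha> k \<in> borel_measurable borel"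
  unfolding asd_power_def [abs_def] by measurable

lemma borel_measurable_link_prob [measurable]:
  "p\<^sub>L \<in> borel_measurable borel \<Longrightarrow> link_prob p\<^sub>L k \<in> borel_measurable borel"
  unfolding link_prob_def [abs_def] by (cases k) simp_all

lemma height_le_abs_distance: "0 < h \<Longrightarrow> h \<le> abs_distance c h x"
  unfolding abs_distance_eq by (intro real_le_rsqrt) auto

lemma asd_power_pos:
  "0 < P\<^sub>M \<Longrightarrow> 0 < \<rho>\<^sub>A \<Longrightarrow> 0 < \<eta> k \<Longrightarrow> 0 < z \<Longrightarrow> 0 < asd_power P\<^sub>M \<rho>\<^sub>A \<eta> \<alpha> k z"
  by (simp add: asd_power_def)

text \<open>\<open>D\<close> solves
  \<open>\<rho>\<^sub>A * D powr \<alpha> k / \<eta> k = P\<^sub>M\<close>, and the left side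
  increases in the distance. Both cases include \<open>z = D\<close>, where the two values
  agree.\<close>

lemma asd_power_cases:
  fixes P\<^sub>M \<rho>\<^sub>A :: real and \<eta> \<alpha> :: "link_state \<Rightarrow> real"
  assumes "0 < P\<^sub>M" "0 < \<rho>\<^sub>A" "0 < \<eta> k" "0 < \<alpha> k" "0 < z"
  defines "D \<equiv> (P\<^sub>M * \<eta> k / \<rho>\<^sub>A) powr (1 / \<alpha> k)"
  shows "z \<le> D \<Longrightarrow> asd_power P\<^sub>M \<rho>\<^sub>A \<eta> \<alpha> k z = \<rho>\<^sub>A / \<eta> k * z powr \<alpha> k"
    and "D \<le> z \<Longrightarrow> asd_power P\<^sub>M \<rho>\<^sub>A \<eta> \<alpha> k z = P\<^sub>M"
proof -
  have D: "D powr \<alpha> k = P\<^sub>M * \<eta> k / \<rho>\<^sub>A" "0 < D"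
    using assms by (simp_all add: D_def powr_powr)
  show "asd_power P\<^sub>M \<rho>\<^sub>A \<eta> \<alpha> k z = \<rho>\<^sub>A / \<eta> k * z powr \<alpha> k" if "z \<le> D"
    using powr_mono2[of "\<alpha> k" z D] that assms(1-5) D by (simp add: asd_power_def min_def field_simps)
  show "asd_power P\<^sub>M \<rho>\<^sub>A \<eta> \<alpha> k z = P\<^sub>M" if "D \<le> z"
    using powr_mono2[of "\<alpha> k" D z] that assms(1-5) D by (simp add: asd_power_def min_def field_simps)
qed

text \<open>Otherwise, at distance \<open>D NLOS\<close> the NLOS path loss is exactly
  \<open>\<rho>\<^sub>A / P\<^sub>M\<close> and the LOS one is at most that, against
  \<open>loss\<close> at this point.\<close>

lemma full_power_distance_less:
  fixes P\<^sub>M \<rho>\<^sub>A :: real and \<eta> \<alpha> :: "link_state \<Rightarrow> real"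
  assumes "0 < P\<^sub>M" "0 < \<rho>\<^sub>A" "\<And>k. 0 < \<eta> k" "\<And>k. 0 < \<alpha> k"
    and loss: "\<And>z. h \<le> z \<Longrightarrow> aerial_path_loss \<eta> \<alpha> NLOS z < aerial_path_loss \<eta> \<alpha> LOS z"
  defines "D \<equiv> \<lambda>k. (P\<^sub>M * \<eta> k / \<rho>\<^sub>A) powr (1 / \<alpha> k)"
  assumes "h \<le> D NLOS"
  shows "D NLOS < D LOS"
proof (rule ccontr)
  assume "\<not> D NLOS < D LOS"
  then have "D LOS powr \<alpha> LOS \<le> D NLOS powr \<alpha> LOS"
    using assms(4) by (intro powr_mono2) (auto simp: D_def less_imp_le)
  moreover have D: "D k powr \<alpha> k = P\<^sub>M * \<eta> k / \<rho>\<^sub>A" "0 < D k" for k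
    using assms(1,2) assms(3,4)[of k] by (simp_all add: D_def powr_powr)
  ultimately have "P\<^sub>M * \<eta> LOS / \<rho>\<^sub>A \<le> D NLOS powr \<alpha> LOS" by simp
  then have "\<eta> LOS / D NLOS powr \<alpha> LOS \<le> \<rho>\<^sub>A / P\<^sub>M"
    using assms(1-3) D(2)[of NLOS] by (simp add: pos_divide_le_eq pos_le_divide_eq mult_ac)
  moreover have "\<eta> NLOS / D NLOS powr \<alpha> NLOS = \<rho>\<^sub>A / P\<^sub>M"
    using assms(1,2) less_imp_neq[OF assms(3)[of NLOS]] by (simp add: D(1))
  ultimately show False
    using loss[OF \<open>h \<le> D NLOS\<close>] by (simp add: aerial_path_loss_def powr_minus_divide)
qed

text \<open>Integrability of \<open>w\<close> justifies the cut at \<open>D\<close>; on each piece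
  \<open>w\<close> is then replaced by \<open>a\<close> or \<open>b\<close>. The three conclusions
  place \<open>D\<close> below, inside and above the range.\<close>

lemma interval_integral_crossover:
  fixes w a b :: "real \<Rightarrow> real"
  assumes int: "interval_lebesgue_integrable lborel (ereal h) (ereal Z) w" and "0 < h" "h \<le> Z"
    and a: "\<And>z. 0 < z \<Longrightarrow> z \<le> D \<Longrightarrow> w z = a z" and b: "\<And>z. 0 < z \<Longrightarrow> D \<le> z \<Longrightarrow> w z = b z"
  shows "D \<le> h \<Longrightarrow> (LBINT z=ereal h..ereal Z. w z) = (LBINT z=ereal h..ereal Z. b z)"
    and "h \<le> D \<Longrightarrow> D \<le> Z \<Longrightarrow> (LBINT z=ereal h..ereal Z. w z)
      = (LBINT z=ereal h..ereal D. a z) + (LBINT z=ereal D..ereal Z. b z)"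
    and "Z \<le> D \<Longrightarrow> (LBINT z=ereal h..ereal Z. w z) = (LBINT z=ereal h..ereal Z. a z)"
proof -
  show "(LBINT z=ereal h..ereal Z. w z) = (LBINT z=ereal h..ereal Z. b z)" if "D \<le> h"
    by (rule interval_integral_cong) (use that assms(2,3) in \<open>auto simp: einterval_iff intro!: b\<close>)
  show "(LBINT z=ereal h..ereal Z. w z) = (LBINT z=ereal h..ereal Z. a z)" if "Z \<le> D"
    by (rule interval_integral_cong) (use that assms(2,3) in \<open>auto simp: einterval_iff intro!: a\<close>)
  assume D: "h \<le> D" "D \<le> Z"
  have "(LBINT z=ereal h..ereal Z. w z) = (LBINT z=ereal h..ereal D. w z) + (LBINT z=ereal D..ereal Z. w z)"
    by (rule interval_integral_sum[symmetric]) (use D assms(3) int in \<open>simp add: min_def max_def\<close>)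
  also have "(LBINT z=ereal h..ereal D. w z) = (LBINT z=ereal h..ereal D. a z)"
    by (rule interval_integral_cong) (use D assms(2,3) in \<open>auto simp: einterval_iff intro!: a\<close>)
  also have "(LBINT z=ereal D..ereal Z. w z) = (LBINT z=ereal D..ereal Z. b z)"
    by (rule interval_integral_cong) (use D assms(2,3) in \<open>auto simp: einterval_iff intro!: b\<close>)
  finally show "(LBINT z=ereal h..ereal Z. w z)
      = (LBINT z=ereal h..ereal D. a z) + (LBINT z=ereal D..ereal Z. b z)" .
qed

section \<open>Coverage probability at the terrestrial base station\<close>

theorem theorem1:
  fixes M :: "'w measure"
    and c :: "real^2"
    and R\<^sub>2 d h \<alpha>\<^sub>T \<rho>\<^sub>A \<rho>\<^sub>T P\<^sub>M \<sigma> \<gamma> :: real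
    and p\<^sub>L :: "real \<Rightarrow> real"
    and \<alpha> \<eta> :: "link_state \<Rightarrow> real"
    and X :: "'w \<Rightarrow> real^2"
    and K :: "'w \<Rightarrow> link_state"
    and H\<^sub>T H\<^sub>A :: "'w \<Rightarrow> real"
  defines "Z\<^sub>A \<equiv> \<lambda>w. abs_distance c h (X w)"
    and "d\<^sub>A \<equiv> \<lambda>w. tbs_distance (X w)"
    and "p \<equiv> link_prob p\<^sub>L"
  defines "P \<equiv> \<lambda>w. asd_power P\<^sub>M \<rho>\<^sub>A \<eta> \<alpha> (K w) (Z\<^sub>A w)"
  defines "I \<equiv> \<lambda>w. P w * H\<^sub>A w * d\<^sub>A w powr (- \<alpha>\<^sub>T)"
    and "SINR \<equiv> \<lambda>w. \<rho>\<^sub>T * H\<^sub>T w / (P w * H\<^sub>A w * d\<^sub>A w powr (- \<alpha>\<^sub>T) + \<sigma>\<^sup>2)"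
    and "s \<equiv> \<gamma> / \<rho>\<^sub>T"
    and "Z\<^sub>M \<equiv> sqrt (h\<^sup>2 + R\<^sub>2\<^sup>2)"
    and "\<l> \<equiv> ell h d \<alpha>\<^sub>T"
    and "f \<equiv> \<lambda>z::real. 2 * z / R\<^sub>2\<^sup>2"
    and "D \<equiv> \<lambda>k. (P\<^sub>M * \<eta> k / \<rho>\<^sub>A) powr (1 / \<alpha> k)"
  defines "E \<equiv> \<lambda>k. if D k < R\<^sub>2 then 0 else sqrt ((D k)\<^sup>2 - R\<^sub>2\<^sup>2)"
    and "A \<equiv> \<lambda>k a b. LBINT z=ereal a..ereal b. (LBINT \<theta>=0..ereal (2 * pi).
                p k z * \<l> s (\<rho>\<^sub>A / \<eta> k * z powr \<alpha> k) \<theta> z * (1 / (2 * pi)) * f z)"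
    and "B \<equiv> \<lambda>k a b. LBINT z=ereal a..ereal b. (LBINT \<theta>=0..ereal (2 * pi).
                p k z * \<l> s P\<^sub>M \<theta> z * (1 / (2 * pi)) * f z)"
  assumes "prob_space M"
    and "R\<^sub>2 > 0" and "d > 0" and "h > 0" and "norm c = d"
    and "\<alpha>\<^sub>T > 0" and "\<rho>\<^sub>A > 0" and "\<rho>\<^sub>T > 0" and "P\<^sub>M > 0" and "\<sigma>\<^sup>2 > 0" and "\<gamma> > 0"
    and "\<And>k. \<alpha> k > 0" and "\<And>k. \<eta> k > 0" and "\<eta> LOS > \<eta> NLOS"
    and "\<And>z. z \<ge> h \<Longrightarrow> aerial_path_loss \<eta> \<alpha> LOS z > aerial_path_loss \<eta> \<alpha> NLOS z"
    and "p\<^sub>L \<in> borel_measurable borel" and "\<And>z. z \<ge> h \<Longrightarrow> 0 \<le> p\<^sub>L z \<and> p\<^sub>L z \<le> 1"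
    and "X \<in> borel_measurable M"
    and "distr M lborel X = uniform_measure lborel (cball c R\<^sub>2)"
    and "K \<in> measurable M (count_space UNIV)"
    and "\<And>k. AE w in M.
           real_cond_exp M (vimage_algebra (space M) X borel) (indicator {v \<in> space M. K v = k}) w
             = p k (Z\<^sub>A w)"
    and "distributed M lborel H\<^sub>T (exponential_density 1)"
    and "distributed M lborel H\<^sub>A (exponential_density 1)"
    and "prob_space.indep_var M borel H\<^sub>T borel H\<^sub>A"
    and "prob_space.indep_set M
           (sets (vimage_algebra (space M) (\<lambda>w. (H\<^sub>T w, H\<^sub>A w)) (borel \<Otimes>\<^sub>M borel)))
           (sets (vimage_algebra (space M) (\<lambda>w. (X w, K w)) (borel \<Otimes>\<^sub>M count_space UNIV)))"
  shows "\<P>(w in M. SINR w > \<gamma>) = exp (- (\<gamma> / \<rho>\<^sub>T) * \<sigma>\<^sup>2) * laplace_transform M I s \<and>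
    (h \<ge> D LOS \<longrightarrow>
       laplace_transform M I s =
         (LBINT z=ereal h..ereal Z\<^sub>M. (LBINT \<theta>=0..ereal (2 * pi).
            \<l> s P\<^sub>M \<theta> z * (1 / (2 * pi)) * f z))) \<and>
    ((E LOS < D NLOS \<and> D NLOS < h \<and> h < D LOS) \<or>
      (D NLOS < E LOS \<and> E LOS \<le> h \<and> h < D LOS) \<longrightarrow>
       laplace_transform M I s =
         A LOS h (D LOS) + B LOS (D LOS) Z\<^sub>M + B NLOS h Z\<^sub>M) \<and>
    (E LOS < h \<and> h \<le> D NLOS \<longrightarrow>
       laplace_transform M I s =
         A LOS h (D LOS) + B LOS (D LOS) Z\<^sub>M + A NLOS h (D NLOS) + B NLOS (D NLOS) Z\<^sub>M) \<and>
    (D NLOS \<le> h \<and> h < E LOS \<longrightarrow>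
       laplace_transform M I s = A LOS h Z\<^sub>M + B NLOS h Z\<^sub>M) \<and>
    ((E NLOS < h \<and> h \<le> E LOS \<and> E LOS < D NLOS) \<or>
      (E NLOS < h \<and> h < D NLOS \<and> D NLOS < E LOS) \<longrightarrow>
       laplace_transform M I s =
         A LOS h Z\<^sub>M + A NLOS h (D NLOS) + B NLOS (D NLOS) Z\<^sub>M) \<and>
    (h \<le> E NLOS \<longrightarrow>
       laplace_transform M I s = A LOS h Z\<^sub>M + A NLOS h Z\<^sub>M)"
proof -
  interpret prob_space M by fact
  have pos: "0 < R\<^sub>2" "0 < d" "0 < h" "norm c = d" "0 < \<alpha>\<^sub>T" "0 < \<rho>\<^sub>A" "0 < \<rho>\<^sub>T" "0 < P\<^sub>M" "0 < \<sigma>\<^sup>2" "0 < \<gamma>"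
    "\<And>k. 0 < \<alpha> k" "\<And>k. 0 < \<eta> k" by fact+
  have loss: "\<And>z. z \<ge> h \<Longrightarrow> aerial_path_loss \<eta> \<alpha> LOS z > aerial_path_loss \<eta> \<alpha> NLOS z" by fact
  have pL [measurable]: "p\<^sub>L \<in> borel_measurable borel"
    and pL01: "\<And>z. z \<ge> h \<Longrightarrow> 0 \<le> p\<^sub>L z \<and> p\<^sub>L z \<le> 1" by fact+
  have X [measurable]: "X \<in> borel_measurable M"
    and U: "distr M lborel X = uniform_measure lborel (cball c R\<^sub>2)"
    and K [measurable]: "K \<in> measurable M (count_space UNIV)" by fact+
  have "\<And>k. AE w in M.
           real_cond_exp M (vimage_algebra (space M) X borel) (indicator {v \<in> space M. K v = k}) w
             = p k (Z\<^sub>A w)" by fact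
  then have q: "\<And>k. AE w in M.
           real_cond_exp M (vimage_algebra (space M) X borel) (indicator {v \<in> space M. K v = k}) w
             = p k (abs_distance c h (X w))"
    by (simp only: Z\<^sub>A_def)
  have T: "distributed M lborel H\<^sub>T (exponential_density 1)"
    and A: "distributed M lborel H\<^sub>A (exponential_density 1)"
    and TA: "indep_var borel H\<^sub>T borel H\<^sub>A"
    and TAY: "indep_set
           (sets (vimage_algebra (space M) (\<lambda>w. (H\<^sub>T w, H\<^sub>A w)) (borel \<Otimes>\<^sub>M borel)))
           (sets (vimage_algebra (space M) (\<lambda>w. (X w, K w)) (borel \<Otimes>\<^sub>M count_space UNIV)))" by fact+
  have [measurable]: "H\<^sub>T \<in> borel_measurable M" "H\<^sub>A \<in> borel_measurable M"
    using distributed_measurable[OF T] distributed_measurable[OF A] by simp_all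
  have s: "0 < s" using pos by (simp add: s_def)

  \<comment> \<open>\<open>g\<close> is the interference per unit of fading gain. It depends only on
    position and link state, hence is independent of both gains.\<close>
  define g where "g = (\<lambda>(x, k). asd_power P\<^sub>M \<rho>\<^sub>A \<eta> \<alpha> k (abs_distance c h x) * tbs_distance x powr (- \<alpha>\<^sub>T))"
  have g_meas [measurable]: "g \<in> borel_measurable (borel \<Otimes>\<^sub>M count_space UNIV)"
    unfolding g_def split_beta'
    by (rule measurable_compose_countable'[OF _ measurable_snd countable_UNIV_link_state]) simp
  have power_pos: "0 < asd_power P\<^sub>M \<rho>\<^sub>A \<eta> \<alpha> k z" if "h \<le> z" for k z
    using that pos by (intro asd_power_pos) auto
  have g_nonneg: "0 \<le> g y" for y
    using power_pos[OF height_le_abs_distance[OF \<open>0 < h\<close>]]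
    by (auto simp: g_def split_beta' less_imp_le)
  have I: "I w = g (X w, K w) * H\<^sub>A w" for w
    by (simp add: I_def P_def Z\<^sub>A_def d\<^sub>A_def g_def mult_ac)
  have SINR: "SINR = (\<lambda>w. \<rho>\<^sub>T * H\<^sub>T w / (I w + \<sigma>\<^sup>2))"
    by (simp only: SINR_def I_def)
  have Y [measurable]: "(\<lambda>w. (X w, K w)) \<in> M \<rightarrow>\<^sub>M borel \<Otimes>\<^sub>M count_space UNIV" by measurable

  \<comment> \<open>Factoring out the noise\<close>
  have sinr: "\<P>(w in M. SINR w > \<gamma>) = exp (- (\<gamma> / \<rho>\<^sub>T) * \<sigma>\<^sup>2) * laplace_transform M I s"
  proof -
    \<comment> \<open>\<open>V\<close> is the level that \<open>H\<^sub>T\<close> has to exceed.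
      Truncating the gain at 0 makes it nonnegative everywhere and alters it only on a null
      event.\<close>
    define V where "V = (\<lambda>a y. s * (g y * max 0 a + \<sigma>\<^sup>2))"
    have "\<P>(w in M. SINR w > \<gamma>) = \<P>(w in M. V (H\<^sub>A w) (X w, K w) < H\<^sub>T w)"
    proof (rule measure_eq_AE)
      have "(SINR w > \<gamma>) = (V (H\<^sub>A w) (X w, K w) < H\<^sub>T w)" if "0 < H\<^sub>A w" for w
      proof -
        have "0 \<le> I w" using g_nonneg that by (simp add: I)
        then have "(SINR w > \<gamma>) = (\<gamma> * (I w + \<sigma>\<^sup>2) < \<rho>\<^sub>T * H\<^sub>T w)"
          using pos by (simp add: SINR pos_less_divide_eq add_nonneg_pos)
        also have "\<dots> = (s * (I w + \<sigma>\<^sup>2) < H\<^sub>T w)"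
          using pos by (simp add: s_def field_simps)
        finally show ?thesis using that by (simp add: V_def I)
      qed
      then show "AE w in M. (w \<in> {w \<in> space M. SINR w > \<gamma>}) = (w \<in> {w \<in> space M. V (H\<^sub>A w) (X w, K w) < H\<^sub>T w})"
        using exponential_distributed_nonneg[OF A] by (auto elim!: eventually_mono)
      have [measurable]: "SINR \<in> borel_measurable M"
        unfolding SINR I by measurable
      show "{w \<in> space M. SINR w > \<gamma>} \<in> sets M" by measurable
      show "{w \<in> space M. V (H\<^sub>A w) (X w, K w) < H\<^sub>T w} \<in> sets M"
        unfolding V_def by measurable
    qed
    also have "\<dots> = expectation (\<lambda>w. exp (- V (H\<^sub>A w) (X w, K w)))"
      by (rule exponential_exceeds_independent[OF T TA Y TAY])
        (use s g_nonneg in \<open>auto simp: V_def\<close>)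
    also have "\<dots> = expectation (\<lambda>w. exp (- (s * \<sigma>\<^sup>2)) * exp (- s * I w))"
    proof (rule integral_cong_AE)
      have "exp (- V (H\<^sub>A w) (X w, K w)) = exp (- (s * \<sigma>\<^sup>2)) * exp (- s * I w)" if "0 < H\<^sub>A w" for w
        using that by (simp add: V_def I mult_exp_exp algebra_simps)
      then show "AE w in M. exp (- V (H\<^sub>A w) (X w, K w)) = exp (- (s * \<sigma>\<^sup>2)) * exp (- s * I w)"
        using exponential_distributed_nonneg[OF A] by (auto elim!: eventually_mono)
    qed (simp_all add: V_def I)
    finally show ?thesis by (simp add: laplace_transform_def s_def)
  qed

  \<comment> \<open>\<open>G k x\<close> is the mean of \<open>exp (- s * I w)\<close> over the
    fading, given state \<open>k\<close> and position \<open>x\<close>. At \<open>x = 0\<close> the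
    value 0 follows the convention in \<open>ell\<close>; the fraction would give 1, because
    \<open>0 powr (- \<alpha>\<^sub>T) = 0\<close>.\<close>
  define G where "G = (\<lambda>k x. if x = 0 then 0 else
     1 / (1 + s * (asd_power P\<^sub>M \<rho>\<^sub>A \<eta> \<alpha> k (abs_distance c h x) * norm x powr (- \<alpha>\<^sub>T))))"
  have G_meas [measurable]: "G k \<in> borel_measurable borel" for k
    unfolding G_def by measurable
  have p_meas [measurable]: "p k \<in> borel_measurable borel" for k
    unfolding p_def by measurable
  have G01: "0 \<le> G k x" "G k x \<le> 1" for k x
    using power_pos[OF height_le_abs_distance[OF \<open>0 < h\<close>], of k c x] s
    by (auto simp: G_def divide_le_eq_1 add_pos_nonneg intro!: divide_nonneg_nonneg add_nonneg_nonneg mult_nonneg_nonneg)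
  have p01: "0 \<le> p k z" "p k z \<le> 1" if "h \<le> z" for k z
    using pL01[OF that] by (cases k; simp add: p_def link_prob_def)+

  \<comment> \<open>Contribution of each link state as an integral over the stadium\<close>
  define W where "W = (\<lambda>k z. (LBINT \<theta>=0..ereal (2 * pi).
      p k z * \<l> s (asd_power P\<^sub>M \<rho>\<^sub>A \<eta> \<alpha> k z) \<theta> z * (1 / (2 * pi)) * f z))"
  \<comment> \<open>The unit vector from the centre of the stadium towards the terrestrial station
    at the origin.\<close>
  define u where "u = (- 1 / d) *\<^sub>R c"
  have u: "norm u = 1" "c = - d *\<^sub>R u" using pos by (simp_all add: u_def)
  have Z: "h \<le> Z\<^sub>M" using pos by (auto simp: Z\<^sub>M_def intro!: real_le_rsqrt)
  have area: "measure lborel (cball c R\<^sub>2) = pi * R\<^sub>2\<^sup>2"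
    using pos by (simp add: content_cball unit_ball_vol_2)

  have stadium: "expectation (\<lambda>w. p k (abs_distance c h (X w)) * G k (X w)) = (LBINT z=ereal h..ereal Z\<^sub>M. W k z)"
    and W_int: "interval_lebesgue_integrable lborel (ereal h) (ereal Z\<^sub>M) (W k)" for k
  proof -
    define F where "F = (\<lambda>x. p k (abs_distance c h x) * G k x)"
    have F [measurable]: "F \<in> borel_measurable borel" unfolding F_def by measurable
    have B: "\<bar>F x\<bar> \<le> 1" for x
      using G01[of k x] p01[OF height_le_abs_distance[OF \<open>0 < h\<close>], of k c x]
      by (simp add: F_def mult_le_one)
    \<comment> \<open>The weight \<open>1 / (2 * pi) * f z\<close> times the area
      \<open>pi * R\<^sub>2\<^sup>2\<close> is the Jacobian \<open>z\<close>; the area cancels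
      against the uniform density.\<close>
    have W: "(LBINT \<theta>=0..ereal (2 * pi). z * F (stadium_point h c u z \<theta>)) = W k z * (pi * R\<^sub>2\<^sup>2)" if "h < z" for z
    proof -
      have *: "z * F (stadium_point h c u z \<theta>)
          = p k z * \<l> s (asd_power P\<^sub>M \<rho>\<^sub>A \<eta> \<alpha> k z) \<theta> z * (1 / (2 * pi)) * f z * (pi * R\<^sub>2\<^sup>2)" for \<theta>
        using that pos u s power_pos[of z k] abs_distance_stadium_point[OF u(1) \<open>0 < h\<close>, of z c \<theta>]
          ell_stadium_point[OF u(1) \<open>0 < h\<close>, of z s "asd_power P\<^sub>M \<rho>\<^sub>A \<eta> \<alpha> k z" d \<alpha>\<^sub>T \<theta>]
        by (simp add: F_def G_def f_def \<l>_def)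
      show ?thesis unfolding W_def * by simp
    qed
    have "expectation (\<lambda>w. F (X w)) = (LINT x : cball c R\<^sub>2 | lborel. F x) / (pi * R\<^sub>2\<^sup>2)"
      unfolding area[symmetric] 
      by (rule expectation_uniform[OF X U])
        (use emeasure_lborel_cball_finite[of c R\<^sub>2] pos area in \<open>auto simp: measure_def\<close>)
    also have "(LINT x : cball c R\<^sub>2 | lborel. F x)
        = (LBINT z=ereal h..ereal Z\<^sub>M. (LBINT \<theta>=0..ereal (2 * pi). z * F (stadium_point h c u z \<theta>)))"
      unfolding Z\<^sub>M_def by (rule stadium_integral[OF u(1) _ _ F B]) (use pos in auto)
    also have "\<dots> = (LBINT z=ereal h..ereal Z\<^sub>M. W k z * (pi * R\<^sub>2\<^sup>2))"
      by (rule interval_integral_cong) (use Z in \<open>auto simp: einterval_iff W simp del: interval_lebesgue_integral_mult_right\<close>)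
    also have "\<dots> / (pi * R\<^sub>2\<^sup>2) = (LBINT z=ereal h..ereal Z\<^sub>M. W k z)"
      using pos by simp
    finally show "expectation (\<lambda>w. p k (abs_distance c h (X w)) * G k (X w)) = (LBINT z=ereal h..ereal Z\<^sub>M. W k z)"
      by (simp add: F_def)
    have int: "interval_lebesgue_integrable lborel (ereal h) (ereal Z\<^sub>M)
        (\<lambda>z. (LBINT \<theta>=0..ereal (2 * pi). z * F (stadium_point h c u z \<theta>)))"
      unfolding Z\<^sub>M_def by (rule stadium_integrable[OF u(1) _ _ F B]) (use pos in auto)
    have "interval_lebesgue_integrable lborel (ereal h) (ereal Z\<^sub>M) (\<lambda>z. W k z * (pi * R\<^sub>2\<^sup>2))"
    proof -
      have "set_integrable lborel {h<..<Z\<^sub>M} (\<lambda>z. W k z * (pi * R\<^sub>2\<^sup>2)) \<longleftrightarrow>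
          set_integrable lborel {h<..<Z\<^sub>M} (\<lambda>z. (LBINT \<theta>=0..ereal (2 * pi). z * F (stadium_point h c u z \<theta>)))"
        by (rule set_integrable_cong[OF refl]) (auto simp del: interval_lebesgue_integral_mult_right intro: W[symmetric])
      then show ?thesis
        using int Z by (simp add: interval_lebesgue_integrable_def del: interval_lebesgue_integral_mult_right)
    qed
    then have "interval_lebesgue_integrable lborel (ereal h) (ereal Z\<^sub>M) (\<lambda>z. W k z * (pi * R\<^sub>2\<^sup>2) / (pi * R\<^sub>2\<^sup>2))"
      by (rule interval_lebesgue_integrable_divide)
    then show "interval_lebesgue_integrable lborel (ereal h) (ereal Z\<^sub>M) (W k)"
      using pos by simp
  qed

  \<comment> \<open>Laplace transform of the interference\<close>
  have AY: "indep_set (sets (vimage_algebra (space M) H\<^sub>A borel))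
      (sets (vimage_algebra (space M) (\<lambda>w. (X w, K w)) (borel \<Otimes>\<^sub>M count_space UNIV)))"
    by (rule indep_set_vimage_snd[OF TAY])
  have laplace: "laplace_transform M I s = (LBINT z=ereal h..ereal Z\<^sub>M. W LOS z) + (LBINT z=ereal h..ereal Z\<^sub>M. W NLOS z)"
  proof -
    \<comment> \<open>Truncating the gain at 0 bounds the integrand by 1 for all arguments, as
      \<open>iterated_expectation_indep\<close> requires.\<close>
    have "laplace_transform M I s = expectation (\<lambda>w. exp (- (s * g (X w, K w) * max 0 (H\<^sub>A w))))"
      unfolding laplace_transform_def
    proof (rule integral_cong_AE)
      show "AE w in M. exp (- s * I w) = exp (- (s * g (X w, K w) * max 0 (H\<^sub>A w)))"
        by (rule eventually_mono[OF exponential_distributed_nonneg[OF A]]) (simp add: I)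
    qed (simp_all add: I)
    also have "\<dots> = expectation (\<lambda>w. expectation (\<lambda>w'. exp (- (s * g (X w, K w) * max 0 (H\<^sub>A w')))))"
      using iterated_expectation_indep[OF _ Y AY, of "\<lambda>(a, y). exp (- (s * g y * max 0 a))" 1] s g_nonneg
      by (simp add: split_beta')
    also have "\<dots> = expectation (\<lambda>w. 1 / (1 + s * g (X w, K w)))"
    proof (rule Bochner_Integration.integral_cong [OF refl])
      fix w
      have "expectation (\<lambda>w'. exp (- (s * g (X w, K w) * max 0 (H\<^sub>A w'))))
         = expectation (\<lambda>w'. exp (- (s * g (X w, K w) * H\<^sub>A w')))"
        by (intro integral_cong_AE eventually_mono[OF exponential_distributed_nonneg[OF A]]) simp_all
      also have "\<dots> = 1 / (1 + s * g (X w, K w))"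
        by (rule exponential_distributed_laplace[OF A]) (use s g_nonneg in auto)
      finally show "expectation (\<lambda>w'. exp (- (s * g (X w, K w) * max 0 (H\<^sub>A w')))) = 1 / (1 + s * g (X w, K w))" .
    qed
    also have "\<dots> = expectation (\<lambda>w. G (K w) (X w))"
    proof (rule integral_cong_AE)
      \<comment> \<open>The two integrands can differ only when the device sits at the base station,
        and a single point is null for the uniform law.\<close>
      have "AE x in lborel. x \<noteq> (0 :: real^2)" by (rule AE_lborel_singleton)
      then have "AE x in distr M lborel X. x \<noteq> 0"
        unfolding U by (intro AE_uniform_measureI) auto
      then have "AE w in M. X w \<noteq> 0" by (simp add: AE_distr_iff)
      then show "AE w in M. 1 / (1 + s * g (X w, K w)) = G (K w) (X w)"
        by (rule eventually_mono) (simp add: G_def g_def tbs_distance_def)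
      show "(\<lambda>w. G (K w) (X w)) \<in> borel_measurable M"
        by (rule measurable_compose_countable'[where I=UNIV, OF _ K countable_UNIV_link_state]) simp_all
    qed simp
    also have "\<dots> = expectation (\<lambda>w. p LOS (abs_distance c h (X w)) * G LOS (X w))
        + expectation (\<lambda>w. p NLOS (abs_distance c h (X w)) * G NLOS (X w))"
      by (rule expectation_split_conditional[OF X K _ _ q, where B=1]) (use G01 in simp_all)
    finally show ?thesis by (simp add: stadium)
  qed

  \<comment> \<open>Position of the cap distance within the range of distances\<close>
  have a: "W k z = (LBINT \<theta>=0..ereal (2 * pi). p k z * \<l> s (\<rho>\<^sub>A / \<eta> k * z powr \<alpha> k) \<theta> z * (1 / (2 * pi)) * f z)"
    if "0 < z" "z \<le> D k" for k z
    unfolding W_def using that pos asd_power_cases(1)[of P\<^sub>M \<rho>\<^sub>A \<eta> k \<alpha> z] by (simp add: D_def)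
  have b: "W k z = (LBINT \<theta>=0..ereal (2 * pi). p k z * \<l> s P\<^sub>M \<theta> z * (1 / (2 * pi)) * f z)"
    if "0 < z" "D k \<le> z" for k z
    unfolding W_def using that pos asd_power_cases(2)[of P\<^sub>M \<rho>\<^sub>A \<eta> k \<alpha> z] by (simp add: D_def)
  have capped: "(LBINT z=ereal h..ereal Z\<^sub>M. W k z) = B k h Z\<^sub>M" if "D k \<le> h" for k
    unfolding B_def
    by (rule interval_integral_crossover(1)[where D = "D k", OF W_int \<open>0 < h\<close> Z]) (fact a b that)+
  have crossed: "(LBINT z=ereal h..ereal Z\<^sub>M. W k z) = A k h (D k) + B k (D k) Z\<^sub>M" if "h \<le> D k" "D k \<le> Z\<^sub>M" for k
    unfolding A_def B_def
    by (rule interval_integral_crossover(2)[where D = "D k", OF W_int \<open>0 < h\<close> Z]) (fact a b that)+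
  have uncapped: "(LBINT z=ereal h..ereal Z\<^sub>M. W k z) = A k h Z\<^sub>M" if "Z\<^sub>M \<le> D k" for k
    unfolding A_def
    by (rule interval_integral_crossover(3)[where D = "D k", OF W_int \<open>0 < h\<close> Z]) (fact a b that)+

  have D_less: "h \<le> D NLOS \<Longrightarrow> D NLOS < D LOS"
    unfolding D_def by (rule full_power_distance_less) (use pos loss in auto)
  \<comment> \<open>\<open>E k\<close> is the height at which \<open>D k\<close> equals
    \<open>Z\<^sub>M\<close>. Since \<open>0 < h\<close>, the hypothesis rules out the default value
    0 of \<open>E k\<close>.\<close>
  have E_le: "Z\<^sub>M \<le> D k" if "h \<le> E k" for k
  proof -
    have D: "R\<^sub>2 \<le> D k" "h \<le> sqrt ((D k)\<^sup>2 - R\<^sub>2\<^sup>2)"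
      using that \<open>0 < h\<close> by (auto simp: E_def split: if_splits)
    have "h\<^sup>2 \<le> (sqrt ((D k)\<^sup>2 - R\<^sub>2\<^sup>2))\<^sup>2" "R\<^sub>2\<^sup>2 \<le> (D k)\<^sup>2"
      by (rule power_mono; use D pos in simp)+
    then have "h\<^sup>2 + R\<^sub>2\<^sup>2 \<le> (D k)\<^sup>2" by simp
    then show ?thesis using D pos by (auto simp: Z\<^sub>M_def intro!: real_le_lsqrt)
  qed
  \<comment> \<open>Under the default value \<open>E k = 0\<close>, the hypothesis on
    \<open>h\<close> carries no information; there \<open>D k < R\<^sub>2 \<le> Z\<^sub>M\<close>
    directly.\<close>
  have E_ge: "D k \<le> Z\<^sub>M" if "E k \<le> h" for k
  proof (cases "D k < R\<^sub>2")
    case True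
    have "R\<^sub>2 \<le> Z\<^sub>M" using pos by (auto simp: Z\<^sub>M_def intro!: real_le_rsqrt)
    with True show ?thesis by simp
  next
    case False
    then have "sqrt ((D k)\<^sup>2 - R\<^sub>2\<^sup>2) \<le> h" using that by (simp add: E_def)
    then have "(D k)\<^sup>2 - R\<^sub>2\<^sup>2 \<le> h\<^sup>2" by (rule sqrt_le_D)
    then show ?thesis by (auto simp: Z\<^sub>M_def intro!: real_le_rsqrt)
  qed

  \<comment> \<open>The six configurations of the cap distances\<close>
  have i: "laplace_transform M I s = (LBINT z=ereal h..ereal Z\<^sub>M. (LBINT \<theta>=0..ereal (2 * pi).
            \<l> s P\<^sub>M \<theta> z * (1 / (2 * pi)) * f z))" if "D LOS \<le> h"
  proof -
    \<comment> \<open>If \<open>D NLOS\<close> reached \<open>h\<close>, it would lie below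
      \<open>D LOS\<close>, which is at most \<open>h\<close>.\<close>
    have "D NLOS \<le> h" using that D_less by (cases "h \<le> D NLOS") auto
    then have D: "D k \<le> h" for k using that by (cases k) simp_all
    have "laplace_transform M I s = (LBINT z=ereal h..ereal Z\<^sub>M. W LOS z + W NLOS z)"
      using laplace W_int by simp
    also have "\<dots> = (LBINT z=ereal h..ereal Z\<^sub>M. (LBINT \<theta>=0..ereal (2 * pi).
            \<l> s P\<^sub>M \<theta> z * (1 / (2 * pi)) * f z))"
    proof (rule interval_integral_cong)
      fix z assume "z \<in> einterval (min (ereal h) (ereal Z\<^sub>M)) (max (ereal h) (ereal Z\<^sub>M))"
      then have "h < z" using Z by (auto simp: einterval_iff)
      \<comment> \<open>Both states transmit at full power, so they differ only in the factor
        \<open>p k z\<close>, and these factors add up to 1.\<close>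
      then have "W k z = p k z * (LBINT \<theta>=0..ereal (2 * pi). \<l> s P\<^sub>M \<theta> z * (1 / (2 * pi)) * f z)" for k
        using b[of z k] D[of k] pos by (simp add: mult.assoc)
      moreover have "p LOS z + p NLOS z = 1" by (simp add: p_def link_prob_def)
      ultimately show "W LOS z + W NLOS z = (LBINT \<theta>=0..ereal (2 * pi). \<l> s P\<^sub>M \<theta> z * (1 / (2 * pi)) * f z)"
        by (simp only: flip: distrib_right)
    qed
    finally show ?thesis .
  qed
  have ii: "laplace_transform M I s = A LOS h (D LOS) + B LOS (D LOS) Z\<^sub>M + B NLOS h Z\<^sub>M"
    if "(E LOS < D NLOS \<and> D NLOS < h \<and> h < D LOS) \<or> (D NLOS < E LOS \<and> E LOS \<le> h \<and> h < D LOS)"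
  proof -
    \<comment> \<open>Both alternatives put \<open>D LOS\<close> into the range and
      \<open>D NLOS\<close> at or below its lower end.\<close>
    from that have "h \<le> D LOS" "E LOS \<le> h" "D NLOS \<le> h" by auto
    then show ?thesis by (simp only: laplace crossed capped E_ge)
  qed
  have iii: "laplace_transform M I s =
      A LOS h (D LOS) + B LOS (D LOS) Z\<^sub>M + A NLOS h (D NLOS) + B NLOS (D NLOS) Z\<^sub>M"
    if "E LOS < h \<and> h \<le> D NLOS"
  proof -
    from that D_less have "h \<le> D LOS" "E LOS \<le> h" "h \<le> D NLOS" "D NLOS \<le> D LOS" by auto
    \<comment> \<open>The bound on \<open>D NLOS\<close> is inherited from \<open>D LOS\<close>, as
      the case hypothesis does not mention \<open>E NLOS\<close>.\<close>
    moreover from this E_ge[of LOS] have "D LOS \<le> Z\<^sub>M" "D NLOS \<le> Z\<^sub>M" by auto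
    ultimately show ?thesis by (simp only: laplace crossed add.assoc)
  qed
  have iv: "laplace_transform M I s = A LOS h Z\<^sub>M + B NLOS h Z\<^sub>M"
    if "D NLOS \<le> h \<and> h < E LOS"
  proof -
    from that have "h \<le> E LOS" "D NLOS \<le> h" by auto
    then show ?thesis by (simp only: laplace uncapped capped E_le)
  qed
  have v: "laplace_transform M I s = A LOS h Z\<^sub>M + A NLOS h (D NLOS) + B NLOS (D NLOS) Z\<^sub>M"
    if "(E NLOS < h \<and> h \<le> E LOS \<and> E LOS < D NLOS) \<or> (E NLOS < h \<and> h < D NLOS \<and> D NLOS < E LOS)"
  proof -
    from that have "h \<le> E LOS" "E NLOS \<le> h" "h \<le> D NLOS" by auto
    then show ?thesis by (simp only: laplace uncapped crossed E_le E_ge add.assoc)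
  qed
  have vi: "laplace_transform M I s = A LOS h Z\<^sub>M + A NLOS h Z\<^sub>M" if "h \<le> E NLOS"
  proof -
    have "Z\<^sub>M \<le> D NLOS" using that by (rule E_le)
    \<comment> \<open>Here \<open>h \<le> Z\<^sub>M \<le> D NLOS\<close>, so \<open>D_less\<close>
      carries the bound over to \<open>D LOS\<close>.\<close>
    moreover from this Z D_less have "Z\<^sub>M \<le> D LOS" by auto
    ultimately show ?thesis by (simp only: laplace uncapped)
  qed
  show ?thesis
    by (intro conjI impI sinr) (rule i ii iii iv v vi, assumption)+
qed

end
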